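(* Let $(\mathcal{X},\tau,\mathcal{B})$ be an effective topological space, $n\geq 1$, and $A\subseteq X_c$. The following are equivalent: (a) there exist c.e. sets $A_1\supseteq A_2\supseteq\cdots\supseteq A_n$ of natural numbers such that for every $x\in X_c$ and every Markov name $e$ of $x$, $x\in A$ iff $e\in D_n(A_1,\ldots,A_n)$ (i.e. $A$ is Markov-$n$-c.e.); (b) there exist uniformly effective open sets $\mathcal{U}^1_k,\ldots,\mathcal{U}^n_k\subseteq\mathcal{X}$, $k\in\mathbb{N}$, such that $A\cap X_c(k)=D_n(\mathcal{U}^1_k,\ldots,\mathcal{U}^n_k)\cap X_c(k)$ for every $k$ (i.e. $A$ is K-$n$-c.e.).
   Context: Let $(\varphi_e)$ be a standard enumeration of partial computable functions, $W_e=\mathrm{dom}(\varphi_e)$. An effective topological space is $(\mathcal{X},\tau,\mathcal{B})$ with $(\mathcal{X},\tau)$ a non-empty topological space and $\mathcal{B}=(\mathcal{B}_i)_{i}$ a numbered basis with a total computable $g$ such that $\mathcal{B}_i\cap\mathcal{B}_j=\bigcup_{k\in W_{g(i,j)}}\mathcal{B}_k$. A Type-2 name of $x$ is any $p\in\mathbb{N}^{\mathbb{N}}$ with $\{p(n)\}=\{i:x\in\mathcal{B}_i\}$; $X_c$ is the set of points having a computable Type-2 name. A Markov name of $x\in X_c$ is an $e$ such that $\varphi_e$ is total and a Type-2 name of $x$. $K(x)$ is the length of a shortest program computing a Type-2 name of $x$, and $X_c(k)=\{x\in X_c: K(x)\leq k\}$. An effective open set is one of the form $\bigcup_{i\in W_e}\mathcal{B}_i$;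 sets indexed by $k$ are uniformly effective open if the index $e$ can be computed from $k$. For sets $S_1,\ldots,S_n$, $D_n(S_1,\ldots,S_n)=(S_1\setminus S_2)\cup(S_3\setminus S_4)\cup\cdots$, ending with $(S_{n-1}\setminus S_n)$ if $n$ is even and with $S_n$ if $n$ is odd. *)

theory Defs
  imports "HOL-Analysis.Analysis" "HOL-Library.Discrete_Functions"
begin

text \<open>
  Kleene's partial recursive functions. Programs act on argument lists of arbitrary length; arities
  are fixed only where a program is used to compute a unary or binary partial function.
\<close>

datatype recf =
    Zero
  | Succ
  | Proj nat
  | Comp recf "recf list"
  | PrimRec recf recf
  | Mu recf

inductive evals :: "recf \<Rightarrow> nat list \<Rightarrow> nat \<Rightarrow> bool" where
  evals_Zero: "evals Zero xs 0"
| evals_Succ: "evals Succ (x # xs) (Suc x)"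
| evals_Proj: "i < length xs \<Longrightarrow> evals (Proj i) xs (xs ! i)"
| evals_Comp: "list_all2 (\<lambda>g y. evals g xs y) gs ys \<Longrightarrow> evals f ys z \<Longrightarrow> evals (Comp f gs) xs z"
| evals_PrimRec_0: "evals f xs y \<Longrightarrow> evals (PrimRec f g) (0 # xs) y"
| evals_PrimRec_Suc:
    "evals (PrimRec f g) (m # xs) r \<Longrightarrow> evals g (m # r # xs) y
      \<Longrightarrow> evals (PrimRec f g) (Suc m # xs) y"
| evals_Mu:
    "evals f (m # xs) 0 \<Longrightarrow> (\<And>i. i < m \<Longrightarrow> \<exists>v. evals f (i # xs) (Suc v))
      \<Longrightarrow> evals (Mu f) xs m"

definition partial_computable :: "(nat \<rightharpoonup> nat) \<Rightarrow> bool" where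
  "partial_computable f \<longleftrightarrow> (\<exists>r. \<forall>x y. f x = Some y \<longleftrightarrow> evals r [x] y)"

definition partial_computable2 :: "(nat \<Rightarrow> nat \<rightharpoonup> nat) \<Rightarrow> bool" where
  "partial_computable2 f \<longleftrightarrow> (\<exists>r. \<forall>x1 x2 y. f x1 x2 = Some y \<longleftrightarrow> evals r [x1, x2] y)"

definition computable :: "(nat \<Rightarrow> nat) \<Rightarrow> bool" where
  "computable f \<longleftrightarrow> partial_computable (\<lambda>x. Some (f x))"

definition computable2 :: "(nat \<Rightarrow> nat \<Rightarrow> nat) \<Rightarrow> bool" where
  "computable2 f \<longleftrightarrow> partial_computable2 (\<lambda>x y. Some (f x y))"

text \<open>
  Standard enumerations are taken to be the acceptable numberings in the sense of Rogers: the
  universal function is partial computable (enumeration theorem), and programs for any other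
  uniformly partial computable family can be found effectively (s-m-n theorem).
\<close>

definition standard_enumeration :: "(nat \<Rightarrow> nat \<rightharpoonup> nat) \<Rightarrow> bool" where
  "standard_enumeration \<phi> \<longleftrightarrow>
     range \<phi> = {f. partial_computable f} \<and>
     partial_computable2 \<phi> \<and>
     (\<forall>\<psi>. partial_computable2 \<psi> \<longrightarrow> (\<exists>s. computable s \<and> (\<forall>e. \<phi> (s e) = \<psi> e)))"

definition W :: "(nat \<Rightarrow> nat \<rightharpoonup> nat) \<Rightarrow> nat \<Rightarrow> nat set" where
  "W \<phi> e = dom (\<phi> e)"

definition ce_set :: "(nat \<Rightarrow> nat \<rightharpoonup> nat) \<Rightarrow> nat set \<Rightarrow> bool" where
  "ce_set \<phi> S \<longleftrightarrow> (\<exists>e. S = W \<phi> e)"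

definition effective_topological_space ::
    "(nat \<Rightarrow> nat \<rightharpoonup> nat) \<Rightarrow> 'a topology \<Rightarrow> (nat \<Rightarrow> 'a set) \<Rightarrow> bool" where
  "effective_topological_space \<phi> X B \<longleftrightarrow>
     topspace X \<noteq> {} \<and>
     (\<forall>i. openin X (B i)) \<and>
     (\<forall>S. openin X S \<longrightarrow> (\<exists>I. S = (\<Union>i\<in>I. B i))) \<and>
     (\<exists>g. computable2 g \<and> (\<forall>i j. B i \<inter> B j = (\<Union>k\<in>W \<phi> (g i j). B k)))"

definition type2_name :: "(nat \<Rightarrow> 'a set) \<Rightarrow> (nat \<Rightarrow> nat) \<Rightarrow> 'a \<Rightarrow> bool" where
  "type2_name B p x \<longleftrightarrow> range p = {i. x \<in> B i}"

definition computable_points :: "'a topology \<Rightarrow> (nat \<Rightarrow> 'a set) \<Rightarrow> 'a set" where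
  "computable_points X B = {x \<in> topspace X. \<exists>p. computable p \<and> type2_name B p x}"

definition markov_name ::
    "(nat \<Rightarrow> nat \<rightharpoonup> nat) \<Rightarrow> (nat \<Rightarrow> 'a set) \<Rightarrow> nat \<Rightarrow> 'a \<Rightarrow> bool" where
  "markov_name \<phi> B e x \<longleftrightarrow> (\<exists>p. (\<forall>n. \<phi> e n = Some (p n)) \<and> type2_name B p x)"

text \<open>
  A program is an index of the enumeration, written as a binary string: index \<open>e\<close> stands for
  the \<open>e\<close>-th string in length-lexicographic order (the binary expansion of \<open>e + 1\<close> without
  its leading digit 1), which has length \<open>\<lfloor>log\<^sub>2 (e + 1)\<rfloor>\<close>.
\<close>

definition program_length :: "nat \<Rightarrow> nat" where
  "program_length e = floor_log (e + 1)"

text \<open>The value of \<open>K\<close> is meaningful only at points that have a Markov name.\<close>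

definition K :: "(nat \<Rightarrow> nat \<rightharpoonup> nat) \<Rightarrow> (nat \<Rightarrow> 'a set) \<Rightarrow> 'a \<Rightarrow> nat" where
  "K \<phi> B x = (LEAST l. \<exists>e. markov_name \<phi> B e x \<and> program_length e = l)"

definition computable_points_upto ::
    "(nat \<Rightarrow> nat \<rightharpoonup> nat) \<Rightarrow> 'a topology \<Rightarrow> (nat \<Rightarrow> 'a set) \<Rightarrow> nat \<Rightarrow> 'a set" where
  "computable_points_upto \<phi> X B k = {x \<in> computable_points X B. K \<phi> B x \<le> k}"

definition uniformly_effective_open ::
    "(nat \<Rightarrow> nat \<rightharpoonup> nat) \<Rightarrow> (nat \<Rightarrow> 'a set) \<Rightarrow> (nat \<Rightarrow> 'a set) \<Rightarrow> bool" where
  "uniformly_effective_open \<phi> B U \<longleftrightarrow>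
     (\<exists>h. computable h \<and> (\<forall>k. U k = (\<Union>i\<in>W \<phi> (h k). B i)))"

text \<open>The sets \<open>S\<^sub>1, \<dots>, S\<^sub>n\<close> are the values of \<open>S\<close> at \<open>1, \<dots>, n\<close>.\<close>

definition D :: "nat \<Rightarrow> (nat \<Rightarrow> 'b set) \<Rightarrow> 'b set" where
  "D n S = (\<Union>i\<in>{i \<in> {1..n}. odd i}. if i < n then S i - S (i + 1) else S i)"

definition markov_n_ce ::
    "(nat \<Rightarrow> nat \<rightharpoonup> nat) \<Rightarrow> 'a topology \<Rightarrow> (nat \<Rightarrow> 'a set) \<Rightarrow> nat \<Rightarrow> 'a set \<Rightarrow> bool" where
  "markov_n_ce \<phi> X B n A \<longleftrightarrow>
     (\<exists>C :: nat \<Rightarrow> nat set.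
        (\<forall>i\<in>{1..n}. ce_set \<phi> (C i)) \<and>
        (\<forall>i\<in>{1..<n}. C (i + 1) \<subseteq> C i) \<and>
        (\<forall>x\<in>computable_points X B. \<forall>e. markov_name \<phi> B e x \<longrightarrow> (x \<in> A \<longleftrightarrow> e \<in> D n C)))"

definition K_n_ce ::
    "(nat \<Rightarrow> nat \<rightharpoonup> nat) \<Rightarrow> 'a topology \<Rightarrow> (nat \<Rightarrow> 'a set) \<Rightarrow> nat \<Rightarrow> 'a set \<Rightarrow> bool" where
  "K_n_ce \<phi> X B n A \<longleftrightarrow>
     (\<exists>U :: nat \<Rightarrow> nat \<Rightarrow> 'a set.
        (\<forall>i\<in>{1..n}. uniformly_effective_open \<phi> B (U i)) \<and>
        (\<forall>k. A \<inter> computable_points_upto \<phi> X B k =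
             D n (\<lambda>i. U i k) \<inter> computable_points_upto \<phi> X B k))"

end

theory Submission
  imports Defs
begin

text \<open>
  From \<open>K\<close> to Markov: a Markov name \<open>e\<close> of \<open>x\<close> satisfies \<open>K x \<le> program_length e\<close>, so
  \<open>x \<in> A\<close> is decided by the open sets of index \<open>program_length e\<close>, and the program \<open>e\<close>
  semidecides membership of \<open>x\<close> in each of them.

  From Markov to \<open>K\<close>: fix \<open>N\<close> such that every point of complexity at most \<open>k\<close> has a name below
  \<open>N\<close>. By the recursion theorem there is, for all \<open>e\<^sub>0, \<dots>, e\<^sub>n < N\<close>, a program \<open>q\<close> that outputs
  the values of \<open>e\<^sub>i\<close> as long as exactly \<open>i\<close> of the sets \<open>C\<^sub>1, \<dots>, C\<^sub>n\<close> are seen to contain \<open>q\<close>.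
  Let \<open>V\<^sub>i\<close> be the open set of points that are consistent with what \<open>q\<close> has output when \<open>i\<close> sets
  have accepted it, and let \<open>x\<close> belong to \<open>U\<^sub>i\<close> if \<open>\<exists>e\<^sub>0 \<dots> e\<^bsub>i-1\<^esub>. \<forall>e\<^sub>i \<dots> e\<^sub>n. x \<in> V\<^sub>i\<close>. If \<open>i\<close> is
  maximal with \<open>x \<in> U\<^sub>i\<close>, then choosing \<open>e\<^sub>i\<close> to be a name of \<open>x\<close> must, for some
  \<open>e\<^bsub>i+1\<^esub>, \<dots>, e\<^sub>n\<close>, leave \<open>q\<close> in phase \<open>i\<close> forever (otherwise \<open>x \<in> U\<^bsub>i+1\<^esub>\<close>). This \<open>q\<close> is then a
  name of \<open>x\<close> lying in exactly \<open>i\<close> of the sets, whence \<open>x \<in> A\<close> iff \<open>i\<close> is odd.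
\<close>

section \<open>Total recursive functions and pairing\<close>

inductive_cases evals_elims:
  "evals Zero xs y" "evals Succ xs y" "evals (Proj i) xs y" "evals (Comp f gs) xs y"
  "evals (PrimRec f g) (0 # xs) y" "evals (PrimRec f g) (Suc m # xs) y" "evals (PrimRec f g) xs y"
  "evals (Mu f) xs y"

lemma evals_deterministic: "evals r xs y \<Longrightarrow> evals r xs z \<Longrightarrow> y = z"
proof (induction arbitrary: z rule: evals.induct)
  case (evals_Zero xs)
  then show ?case by (rule evals_elims(1)) simp
next
  case (evals_Succ x xs)
  then show ?case by (rule evals_elims(2)) simp
next
  case (evals_Proj i xs)
  from evals_Proj.prems show ?case by (rule evals_elims(3)) simp
next
  case (evals_Comp xs gs ys f z')
  from evals_Comp.prems obtain ys' where ys': "list_all2 (\<lambda>g y. evals g xs y) gs ys'" "evals f ys' z"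
    by (rule evals_elims(4))
  have "ys = ys'"
  proof (rule nth_equalityI)
    show "length ys = length ys'"
      using list_all2_lengthD[OF evals_Comp.IH(1)] list_all2_lengthD[OF ys'(1)] by simp
    then show "ys ! i = ys' ! i" if "i < length ys" for i
      using list_all2_nthD2[OF evals_Comp.IH(1), of i] list_all2_nthD2[OF ys'(1), of i] that by simp
  qed
  with ys'(2) have "evals f ys z" by simp
  then show ?case by (rule evals_Comp.IH(2))
next
  case (evals_PrimRec_0 f xs y g)
  from evals_PrimRec_0.prems have "evals f xs z" by (rule evals_elims(5))
  then show ?case by (rule evals_PrimRec_0.IH)
next
  case (evals_PrimRec_Suc f g m xs r y)
  from evals_PrimRec_Suc.prems obtain r' where r': "evals (PrimRec f g) (m # xs) r'" "evals g (m # r' # xs) z"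
    by (rule evals_elims(6))
  have "r = r'" using r'(1) by (rule evals_PrimRec_Suc.IH(1))
  with r'(2) have "evals g (m # r # xs) z" by simp
  then show ?case by (rule evals_PrimRec_Suc.IH(2))
next
  case (evals_Mu f m xs)
  from evals_Mu.prems have z: "evals f (z # xs) 0" "\<And>i. i < z \<Longrightarrow> \<exists>v. evals f (i # xs) (Suc v)"
    by (rule evals_elims(8), simp)+
  \<comment> \<open>If the two results differed, the smaller one would have the value 0, being a
    zero, and also a successor value, lying below the other result.\<close>
  show ?case
  proof (cases m z rule: linorder_cases)
    case less
    with z(2) evals_Mu.IH(1) show ?thesis by (metis nat.distinct(1))
  next
    case greater
    with z(1) evals_Mu.IH(2) show ?thesis by (metis nat.distinct(1))
  qed
qed

lemma evals_iff_eq: "evals r xs y \<Longrightarrow> evals r xs z \<longleftrightarrow> z = y"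
  using evals_deterministic by blast

text \<open>Only lists of length \<open>m\<close> constrain \<open>f\<close>, so functions can be
  written with \<open>hd\<close>, \<open>tl\<close> and \<open>!\<close> although their values on
  other lists are arbitrary.\<close>

definition total_recursive :: "nat \<Rightarrow> (nat list \<Rightarrow> nat) \<Rightarrow> bool" where
  "total_recursive m f \<longleftrightarrow> (\<exists>r. \<forall>xs. length xs = m \<longrightarrow> evals r xs (f xs))"

lemma total_recursive_cong:
  "total_recursive m f \<Longrightarrow> (\<And>xs. length xs = m \<Longrightarrow> f xs = g xs) \<Longrightarrow> total_recursive m g"
  unfolding total_recursive_def by metis

lemma computable_iff_total_recursive: "computable f \<longleftrightarrow> total_recursive 1 (\<lambda>xs. f (hd xs))"
proof
  assume "computable f"
  then show "total_recursive 1 (\<lambda>xs. f (hd xs))"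
    unfolding computable_def partial_computable_def total_recursive_def One_nat_def length_Suc_conv
    by (metis length_0_conv list.sel(1))
next
  assume "total_recursive 1 (\<lambda>xs. f (hd xs))"
  then obtain r where r: "\<forall>xs. length xs = 1 \<longrightarrow> evals r xs (f (hd xs))"
    unfolding total_recursive_def by blast
  have "evals r [x] (f x)" for x using r[rule_format, of "[x]"] by simp
  then show "computable f"
    unfolding computable_def partial_computable_def by (metis evals_iff_eq option.inject)
qed

lemma computable2_iff_total_recursive:
  "computable2 f \<longleftrightarrow> total_recursive 2 (\<lambda>xs. f (hd xs) (hd (tl xs)))"
proof
  assume "computable2 f"
  then show "total_recursive 2 (\<lambda>xs. f (hd xs) (hd (tl xs)))"
    unfolding computable2_def partial_computable2_def total_recursive_def numeral_2_eq_2 length_Suc_conv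
    by (metis length_0_conv list.sel(1,3))
next
  assume "total_recursive 2 (\<lambda>xs. f (hd xs) (hd (tl xs)))"
  then obtain r where r: "\<forall>xs. length xs = 2 \<longrightarrow> evals r xs (f (hd xs) (hd (tl xs)))"
    unfolding total_recursive_def by blast
  have "evals r [x, y] (f x y)" for x y using r[rule_format, of "[x, y]"] by simp
  then show "computable2 f"
    unfolding computable2_def partial_computable2_def by (metis evals_iff_eq option.inject)
qed

lemma total_recursive_nth: "i < m \<Longrightarrow> total_recursive m (\<lambda>xs. xs ! i)"
  unfolding total_recursive_def by (auto intro: evals_Proj)

lemma total_recursive_compose:
  assumes "total_recursive k f"
    and "\<And>i. i < k \<Longrightarrow> total_recursive m (\<lambda>xs. G xs ! i)"
    and "\<And>xs. length xs = m \<Longrightarrow> length (G xs) = k"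
  shows "total_recursive m (\<lambda>xs. f (G xs))"
proof -
  obtain r where r: "\<And>ys. length ys = k \<Longrightarrow> evals r ys (f ys)"
    using assms(1) unfolding total_recursive_def by blast
  obtain q where q: "\<And>i xs. i < k \<Longrightarrow> length xs = m \<Longrightarrow> evals (q i) xs (G xs ! i)"
    using assms(2) unfolding total_recursive_def by metis
  have "evals (Comp r (map q [0..<k])) xs (f (G xs))" if "length xs = m" for xs
  proof (rule evals_Comp)
    show "list_all2 (\<lambda>g y. evals g xs y) (map q [0..<k]) (G xs)"
      using q that assms(3) by (auto simp: list_all2_conv_all_nth)
    show "evals r (G xs) (f (G xs))"
      using r that assms(3) by blast
  qed
  then show ?thesis unfolding total_recursive_def by blast
qed

lemma total_recursive_hd: "total_recursive (Suc m) hd"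
  by (rule total_recursive_cong[OF total_recursive_nth[of 0]]) (auto simp: length_Suc_conv)

text \<open>Weakening by a new first argument, as needed under the counter and the accumulator of a
  primitive recursion.\<close>

lemma total_recursive_tl: "total_recursive m f \<Longrightarrow> total_recursive (Suc m) (\<lambda>xs. f (tl xs))"
  by (rule total_recursive_compose[where G = tl, of m])
     (simp_all add: total_recursive_cong[OF total_recursive_nth[of "Suc _" "Suc m"]] nth_tl)

lemma total_recursive_Cons:
  assumes "total_recursive (Suc k) f" and "total_recursive m a"
    and "\<And>i. i < k \<Longrightarrow> total_recursive m (\<lambda>xs. G xs ! i)"
    and "\<And>xs. length xs = m \<Longrightarrow> length (G xs) = k"
  shows "total_recursive m (\<lambda>xs. f (a xs # G xs))"
proof (rule total_recursive_compose[OF assms(1)])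
  show "total_recursive m (\<lambda>xs. (a xs # G xs) ! i)" if "i < Suc k" for i
    using that assms(2,3) by (cases i) auto
qed (simp add: assms(4))

lemma total_recursive_computable:
  "computable f \<Longrightarrow> total_recursive m a \<Longrightarrow> total_recursive m (\<lambda>xs. f (a xs))"
  unfolding computable_iff_total_recursive
  by (drule total_recursive_compose[where G = "\<lambda>xs. [a xs]"]) auto

lemma total_recursive_computable2:
  "computable2 f \<Longrightarrow> total_recursive m a \<Longrightarrow> total_recursive m b \<Longrightarrow>
   total_recursive m (\<lambda>xs. f (a xs) (b xs))"
  unfolding computable2_iff_total_recursive
  by (drule total_recursive_compose[where G = "\<lambda>xs. [a xs, b xs]"])
     (auto simp: less_Suc_eq numeral_2_eq_2)

lemma computable_compose: "computable f \<Longrightarrow> computable a \<Longrightarrow> computable (\<lambda>x. f (a x))"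
  using total_recursive_computable[of f 1 "\<lambda>xs. a (hd xs)"] by (simp add: computable_iff_total_recursive)

lemma computable2_compose:
  "computable2 f \<Longrightarrow> computable a \<Longrightarrow> computable b \<Longrightarrow> computable (\<lambda>x. f (a x) (b x))"
  using total_recursive_computable2[of f 1 "\<lambda>xs. a (hd xs)" "\<lambda>xs. b (hd xs)"]
  by (simp add: computable_iff_total_recursive)

lemma computable_Suc: "computable Suc"
  unfolding computable_iff_total_recursive total_recursive_def
  by (auto simp: length_Suc_conv intro!: exI[of _ Succ] evals_Succ)

lemma total_recursive_const: "total_recursive m (\<lambda>_. c)"
proof (induction c)
  case 0
  show ?case unfolding total_recursive_def using evals_Zero by blast
next
  case (Suc c)
  then show ?case using total_recursive_computable[OF computable_Suc] by blast
qed

lemma total_recursive_PrimRec: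
  assumes "total_recursive m a" and "total_recursive (Suc (Suc m)) h"
  shows "total_recursive (Suc m) (\<lambda>xs. rec_nat (a (tl xs)) (\<lambda>i r. h (i # r # tl xs)) (hd xs))"
proof -
  obtain p where p: "\<And>xs. length xs = m \<Longrightarrow> evals p xs (a xs)"
    using assms(1) unfolding total_recursive_def by blast
  obtain q where q: "\<And>xs. length xs = Suc (Suc m) \<Longrightarrow> evals q xs (h xs)"
    using assms(2) unfolding total_recursive_def by blast
  have "evals (PrimRec p q) (i # xs) (rec_nat (a xs) (\<lambda>i r. h (i # r # xs)) i)"
    if "length xs = m" for i xs
  proof (induction i)
    case 0
    show ?case using p[OF that] by (auto intro: evals_PrimRec_0)
  next
    case (Suc i)
    then show ?case using q that by (auto intro: evals_PrimRec_Suc)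
  qed
  then have "evals (PrimRec p q) xs (rec_nat (a (tl xs)) (\<lambda>i r. h (i # r # tl xs)) (hd xs))"
    if "length xs = Suc m" for xs
    using that by (cases xs) auto
  then show ?thesis unfolding total_recursive_def by blast
qed

lemma total_recursive_rec_nat:
  assumes "total_recursive m n" and "total_recursive m a"
    and "total_recursive (Suc (Suc m)) (\<lambda>xs. h (hd xs) (hd (tl xs)) (tl (tl xs)))"
  shows "total_recursive m (\<lambda>xs. rec_nat (a xs) (\<lambda>i r. h i r xs) (n xs))"
  using total_recursive_Cons[OF total_recursive_PrimRec[OF assms(2,3)] assms(1), of "\<lambda>xs. xs"]
  by (simp add: total_recursive_nth)

lemmas total_recursive_var =
  total_recursive_hd total_recursive_tl[OF total_recursive_hd]
  total_recursive_tl[OF total_recursive_tl[OF total_recursive_hd]]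

text \<open>Case distinction is a primitive recursion whose step ignores its counter and
  accumulator.\<close>

lemma total_recursive_if_eq_0:
  assumes "total_recursive m c" "total_recursive m a" "total_recursive m b"
  shows "total_recursive m (\<lambda>xs. if c xs = 0 then a xs else b xs)"
proof -
  have "total_recursive m (\<lambda>xs. rec_nat (a xs) (\<lambda>_ _. b xs) (c xs))"
    using assms by (intro total_recursive_rec_nat total_recursive_tl)
  then show ?thesis
    by (rule total_recursive_cong) (auto simp: gr0_conv_Suc)
qed

lemma computable2_add: "computable2 (+)"
proof -
  have "total_recursive 2 (\<lambda>xs. rec_nat (hd (tl xs)) (\<lambda>_ r. Suc r) (hd xs))"
    unfolding numeral_2_eq_2
    by (intro total_recursive_rec_nat total_recursive_var
      total_recursive_computable[OF computable_Suc])
  moreover have "rec_nat y (\<lambda>_ r. Suc r) x = x + y" for x y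
    by (induction x) auto
  ultimately show ?thesis by (simp add: computable2_iff_total_recursive)
qed

lemma computable_pred: "computable (\<lambda>x. x - 1)"
proof -
  have "total_recursive 1 (\<lambda>xs. rec_nat 0 (\<lambda>i _. i) (hd xs))"
    unfolding One_nat_def by (intro total_recursive_rec_nat total_recursive_var total_recursive_const)
  moreover have "rec_nat 0 (\<lambda>i _. i) x = x - 1" for x :: nat
    by (cases x) auto
  ultimately show ?thesis by (simp add: computable_iff_total_recursive)
qed

lemma computable2_diff: "computable2 (-)"
proof -
  have "total_recursive 2 (\<lambda>xs. rec_nat (hd xs) (\<lambda>_ r. r - 1) (hd (tl xs)))"
    unfolding numeral_2_eq_2
    by (intro total_recursive_rec_nat total_recursive_var total_recursive_computable[OF computable_pred])
  moreover have "rec_nat x (\<lambda>_ r. r - 1) y = x - y" for x y :: nat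
    by (induction y) auto
  ultimately show ?thesis by (simp add: computable2_iff_total_recursive)
qed

lemma computable_triangle: "computable triangle"
proof -
  have "total_recursive 1 (\<lambda>xs. rec_nat 0 (\<lambda>i r. r + Suc i) (hd xs))"
    unfolding One_nat_def
    by (intro total_recursive_rec_nat total_recursive_var total_recursive_const
      total_recursive_computable2[OF computable2_add] total_recursive_computable[OF computable_Suc])
  moreover have "rec_nat 0 (\<lambda>i r. r + Suc i) x = triangle x" for x
    by (induction x) auto
  ultimately show ?thesis by (simp add: computable_iff_total_recursive)
qed

section \<open>Cantor pairing and its projections\<close>

definition pair :: "nat \<Rightarrow> nat \<Rightarrow> nat" where
  "pair a b = prod_encode (a, b)"

definition pfst :: "nat \<Rightarrow> nat" where
  "pfst z = fst (prod_decode z)"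

definition psnd :: "nat \<Rightarrow> nat" where
  "psnd z = snd (prod_decode z)"

lemma pfst_pair [simp]: "pfst (pair a b) = a"
  and psnd_pair [simp]: "psnd (pair a b) = b"
  and pair_pfst_psnd [simp]: "pair (pfst z) (psnd z) = z"
  by (simp_all add: pair_def pfst_def psnd_def)

text \<open>The Cantor pairing runs through the diagonals \<open>a + b = 0, 1, \<dots>\<close>, and the diagonal of
  \<open>Suc z\<close> differs from that of \<open>z\<close> only if \<open>Suc z\<close> is a triangular number. This makes the
  projections primitive recursive.\<close>

definition diagonal :: "nat \<Rightarrow> nat" where
  "diagonal z = pfst z + psnd z"

lemma diagonal_bounds: "triangle (diagonal z) \<le> z" "z < triangle (Suc (diagonal z))"
  and pfst_eq: "pfst z = z - triangle (diagonal z)"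
proof -
  have "z = triangle (diagonal z) + pfst z"
    using pair_pfst_psnd[of z] by (simp add: pair_def prod_encode_def diagonal_def del: pair_pfst_psnd)
  then show "triangle (diagonal z) \<le> z" "z < triangle (Suc (diagonal z))"
    "pfst z = z - triangle (diagonal z)"
    by (auto simp: diagonal_def)
qed

lemma triangle_mono: "a \<le> b \<Longrightarrow> triangle a \<le> triangle b"
  by (induction rule: dec_induct) auto

lemma diagonal_unique:
  assumes "triangle d \<le> z" "z < triangle (Suc d)"
  shows "diagonal z = d"
  using diagonal_bounds[of z] assms triangle_mono[of "Suc d" "diagonal z"]
    triangle_mono[of "Suc (diagonal z)" d] by linarith

text \<open>The order test is phrased as a truncated difference being 0 to match
  \<open>total_recursive_if_eq_0\<close>.\<close>

lemma diagonal_Suc: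
  "diagonal (Suc z) =
     (if triangle (Suc (diagonal z)) - Suc z = 0 then Suc (diagonal z) else diagonal z)"
  using diagonal_bounds[of z] by (auto intro!: diagonal_unique)

lemma computable_diagonal: "computable diagonal"
proof -
  let ?h = "\<lambda>i r. if triangle (Suc r) - Suc i = 0 then Suc r else r"
  have "total_recursive 1 (\<lambda>xs. rec_nat 0 ?h (hd xs))"
    unfolding One_nat_def
    by (intro total_recursive_rec_nat total_recursive_var total_recursive_const total_recursive_if_eq_0
      total_recursive_computable2[OF computable2_diff] total_recursive_computable[OF computable_Suc]
      total_recursive_computable[OF computable_triangle])
  moreover have "rec_nat 0 ?h x = diagonal x" for x
    by (induction x) (simp_all add: diagonal_Suc diagonal_unique[of 0 0])
  ultimately show ?thesis by (simp add: computable_iff_total_recursive)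
qed

lemma computable_id: "computable (\<lambda>x. x)"
  unfolding computable_iff_total_recursive One_nat_def by (rule total_recursive_hd)

lemma computable_const: "computable (\<lambda>_. c)"
  unfolding computable_iff_total_recursive by (rule total_recursive_const)

lemma computable_pfst: "computable pfst"
proof -
  have "computable (\<lambda>z. z - triangle (diagonal z))"
    by (intro computable2_compose[OF computable2_diff] computable_id computable_compose[OF computable_triangle]
      computable_diagonal)
  then show ?thesis by (simp flip: pfst_eq)
qed

lemma computable_psnd: "computable psnd"
proof -
  have "computable (\<lambda>z. diagonal z - pfst z)"
    by (intro computable2_compose[OF computable2_diff] computable_diagonal computable_pfst)
  then show ?thesis by (simp add: diagonal_def)
qed

lemma computable2_pair: "computable2 pair"
proof -
  have "total_recursive 2 (\<lambda>xs. triangle (hd xs + hd (tl xs)) + hd xs)"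
    unfolding numeral_2_eq_2
    by (intro total_recursive_computable2[OF computable2_add] total_recursive_var
      total_recursive_computable[OF computable_triangle])
  then show ?thesis by (simp add: computable2_iff_total_recursive pair_def prod_encode_def)
qed

section \<open>Stage-wise evaluation\<close>

text \<open>The maximum of the individual stages works. Used whenever several computations must have
  finished by a common stage.\<close>

lemma bounded_monotone_choice:
  assumes "\<And>i. i < n \<Longrightarrow> \<exists>s. Q i s" and "\<And>i s s'. i < n \<Longrightarrow> Q i s \<Longrightarrow> s \<le> s' \<Longrightarrow> Q i s'"
  shows "\<exists>s::nat. \<forall>i<n::nat. Q i s"
  using assms
proof (induction n)
  case (Suc n)
  obtain s where s: "\<forall>i<n. Q i s" using Suc by (meson less_SucI)
  obtain s' where s': "Q n s'" using Suc.prems(1) by blast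
  have "Q i (max s s')" if "i < Suc n" for i
    using Suc.prems(2)[OF that, of s "max s s'"] Suc.prems(2)[OF that, of s' "max s s'"] s s' that
    by (auto simp: less_Suc_eq)
  then show ?case by blast
qed simp

text \<open>Kleene's normal form for a single program: \<open>F s xs\<close> is \<open>Suc y\<close> once stage \<open>s\<close> suffices to
  compute the value \<open>y\<close>, and \<open>0\<close> before.\<close>

definition staged :: "nat \<Rightarrow> recf \<Rightarrow> (nat \<Rightarrow> nat list \<Rightarrow> nat) \<Rightarrow> bool" where
  "staged m r F \<longleftrightarrow>
     total_recursive (Suc m) (\<lambda>xs. F (hd xs) (tl xs)) \<and>
     (\<forall>s s' xs y. length xs = m \<longrightarrow> F s xs = Suc y \<longrightarrow> s \<le> s' \<longrightarrow> F s' xs = Suc y) \<and>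
     (\<forall>xs y. length xs = m \<longrightarrow> evals r xs y \<longleftrightarrow> (\<exists>s. F s xs = Suc y))"

lemma staged_total: "staged m r F \<Longrightarrow> total_recursive (Suc m) (\<lambda>xs. F (hd xs) (tl xs))"
  and staged_mono: "staged m r F \<Longrightarrow> F s xs = Suc y \<Longrightarrow> s \<le> s' \<Longrightarrow> length xs = m \<Longrightarrow> F s' xs = Suc y"
  and staged_evals: "staged m r F \<Longrightarrow> length xs = m \<Longrightarrow> evals r xs y \<longleftrightarrow> (\<exists>s. F s xs = Suc y)"
  unfolding staged_def by blast+

lemma staged_total_recursive:
  assumes "total_recursive m f" and "\<And>xs y. length xs = m \<Longrightarrow> evals r xs y \<longleftrightarrow> y = f xs"
  shows "staged m r (\<lambda>_ xs. Suc (f xs))"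
  unfolding staged_def using assms
  by (auto intro!: total_recursive_tl total_recursive_computable[OF computable_Suc])

lemma staged_divergent:
  assumes "\<And>xs y. length xs = m \<Longrightarrow> \<not> evals r xs y"
  shows "staged m r (\<lambda>_ _. 0)"
  unfolding staged_def using assms by (auto intro: total_recursive_const)

lemma staged_Comp:
  assumes F: "staged (length gs) f F" and G: "\<And>g. g \<in> set gs \<Longrightarrow> staged m g (G g)"
  shows "staged m (Comp f gs)
    (\<lambda>s xs. if \<exists>g\<in>set gs. G g s xs = 0 then 0 else F s (map (\<lambda>g. G g s xs - 1) gs))"
    (is "staged m _ ?H")
  unfolding staged_def
proof (intro conjI allI impI)
  \<comment> \<open>The number of inner programs is arbitrary, so the test for missing values is
    assembled by induction over a list \<open>hs\<close> of them.\<close>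
  have "total_recursive (Suc m) (\<lambda>xs. if \<exists>g\<in>set hs. G g (hd xs) (tl xs) = 0 then 0 else 1)"
    if "set hs \<subseteq> set gs" for hs
    using that
  proof (induction hs)
    case Nil
    show ?case using total_recursive_const[of "Suc m" 1] by simp
  next
    case (Cons h hs)
    then have "total_recursive (Suc m) (\<lambda>xs. if G h (hd xs) (tl xs) = 0 then 0 else
        if \<exists>g\<in>set hs. G g (hd xs) (tl xs) = 0 then 0 else 1)"
      using staged_total[OF G, of h] by (intro total_recursive_if_eq_0 total_recursive_const) auto
    then show ?case by (rule total_recursive_cong) simp
  qed
  from this[of gs] have "total_recursive (Suc m) (\<lambda>xs.
      if (if \<exists>g\<in>set gs. G g (hd xs) (tl xs) = 0 then 0 else 1) = (0::nat) then 0
      else F (hd (hd xs # map (\<lambda>g. G g (hd xs) (tl xs) - 1) gs))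
             (tl (hd xs # map (\<lambda>g. G g (hd xs) (tl xs) - 1) gs)))"
    by (intro total_recursive_if_eq_0 total_recursive_const
        total_recursive_Cons[OF staged_total[OF F]] total_recursive_hd)
       (auto intro!: total_recursive_computable[OF computable_pred, simplified] staged_total[OF G])
  then show "total_recursive (Suc m) (\<lambda>xs. ?H (hd xs) (tl xs))"
    by (rule total_recursive_cong) auto
next
  fix s s' xs y
  assume *: "length xs = m" "?H s xs = Suc y" "s \<le> s'"
  then have pos: "\<forall>g\<in>set gs. G g s xs \<noteq> 0" by (metis nat.distinct(1))
  have same: "G g s' xs = G g s xs" if "g \<in> set gs" for g
    using staged_mono[OF G[OF that], of s xs] pos that * by (metis not0_implies_Suc)
  have eq: "map (\<lambda>g. G g s' xs - 1) gs = map (\<lambda>g. G g s xs - 1) gs" using same by simp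
  have "F s (map (\<lambda>g. G g s xs - 1) gs) = Suc y" using * pos by simp
  from staged_mono[OF F this *(3)] have "F s' (map (\<lambda>g. G g s xs - 1) gs) = Suc y"
    by simp
  moreover have "\<not> (\<exists>g\<in>set gs. G g s' xs = 0)" using pos same by simp
  ultimately show "?H s' xs = Suc y" unfolding eq by simp
next
  fix xs :: "nat list" and y
  assume len: "length xs = m"
  show "evals (Comp f gs) xs y \<longleftrightarrow> (\<exists>s. ?H s xs = Suc y)"
  proof
    assume "evals (Comp f gs) xs y"
    then obtain ys where ys: "list_all2 (\<lambda>g y. evals g xs y) gs ys" "evals f ys y"
      by (rule evals_elims(4))
    have len_ys: "length gs = length ys" using list_all2_lengthD[OF ys(1)] .
    have "\<exists>s. \<forall>i<length gs. G (gs ! i) s xs = Suc (ys ! i)"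
    proof (rule bounded_monotone_choice)
      fix i assume i: "i < length gs"
      then have "evals (gs ! i) xs (ys ! i)" using list_all2_nthD[OF ys(1)] by simp
      then show "\<exists>s. G (gs ! i) s xs = Suc (ys ! i)"
        using staged_evals[OF G, of "gs ! i"] i len by simp
    next
      fix i s s' assume "i < length gs" "G (gs ! i) s xs = Suc (ys ! i)" "s \<le> s'"
      then show "G (gs ! i) s' xs = Suc (ys ! i)" using staged_mono[OF G] len by (metis nth_mem)
    qed
    then obtain s where s: "\<forall>i<length gs. G (gs ! i) s xs = Suc (ys ! i)" by blast
    obtain s' where s': "F s' ys = Suc y" using staged_evals[OF F] ys(2) len_ys by auto
    let ?t = "max s s'"
    have t: "G (gs ! i) ?t xs = Suc (ys ! i)" if "i < length gs" for i
      by (rule staged_mono[OF G, of "gs ! i" s]) (use s that len in auto)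
    then have "\<forall>g\<in>set gs. G g ?t xs \<noteq> 0" by (auto simp: in_set_conv_nth)
    moreover have "map (\<lambda>g. G g ?t xs - 1) gs = ys"
      using t len_ys by (auto intro: nth_equalityI)
    moreover have "F ?t ys = Suc y" using staged_mono[OF F s', of ?t] len_ys by simp
    ultimately have "?H ?t xs = Suc y" by auto
    then show "\<exists>s. ?H s xs = Suc y" by blast
  next
    assume "\<exists>s. ?H s xs = Suc y"
    then obtain s where s: "?H s xs = Suc y" by blast
    then have pos: "\<forall>g\<in>set gs. G g s xs \<noteq> 0" by (metis nat.distinct(1))
    let ?ys = "map (\<lambda>g. G g s xs - 1) gs"
    have "evals g xs (G g s xs - 1)" if "g \<in> set gs" for g
      using staged_evals[OF G[OF that] len] pos that by (metis Suc_pred' gr0I)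
    then have "list_all2 (\<lambda>g y. evals g xs y) gs ?ys"
      by (auto simp: list_all2_conv_all_nth)
    moreover have "F s ?ys = Suc y" using s pos by auto
    then have "evals f ?ys y" using staged_evals[OF F, of ?ys y] by auto
    ultimately show "evals (Comp f gs) xs y" by (rule evals_Comp)
  qed
qed

text \<open>The accumulator holds values shifted by one. A missing value 0 persists through all
  further steps, and \<open>r - 1\<close> undoes the shift before \<open>G\<close> is
  applied.\<close>

lemma staged_PrimRec:
  assumes F: "staged m f F" and G: "staged (Suc (Suc m)) g G"
  shows "staged (Suc m) (PrimRec f g)
    (\<lambda>s xs. rec_nat (F s (tl xs)) (\<lambda>i r. if r = 0 then 0 else G s (i # (r - 1) # tl xs)) (hd xs))"
    (is "staged _ _ ?H")
proof -
  define P where "P s zs = rec_nat (F s zs) (\<lambda>i r. if r = 0 then 0 else G s (i # (r - 1) # zs))" for s zs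
  have H: "?H s xs = P s (tl xs) (hd xs)" for s xs unfolding P_def ..
  have P_0 [simp]: "P s zs 0 = F s zs"
    and P_Suc: "P s zs (Suc i) = (if P s zs i = 0 then 0 else G s (i # (P s zs i - 1) # zs))" for s zs i
    unfolding P_def by simp_all
  have mono: "P s zs i = Suc y \<Longrightarrow> s \<le> s' \<Longrightarrow> length zs = m \<Longrightarrow> P s' zs i = Suc y"
    for s s' i y zs
  proof (induction i arbitrary: y)
    case 0
    then show ?case using staged_mono[OF F, of s zs y s'] by simp
  next
    case (Suc i)
    then obtain r where r: "P s zs i = Suc r" by (cases "P s zs i") (auto simp: P_Suc)
    then have "G s (i # r # zs) = Suc y" using Suc.prems by (simp add: P_Suc)
    from staged_mono[OF G this Suc.prems(2)] Suc.prems(3) have "G s' (i # r # zs) = Suc y" by simp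
    then show ?case using Suc.IH[OF r Suc.prems(2,3)] by (simp add: P_Suc)
  qed
  show ?thesis
    unfolding staged_def
  proof (intro conjI allI impI)
    let ?h = "\<lambda>i r xs. if r = 0 then 0 else G (hd xs) (i # (r - 1) # tl (tl xs))"
    have a: "total_recursive (Suc (Suc m)) (\<lambda>xs. F (hd (hd xs # tl (tl xs))) (tl (hd xs # tl (tl xs))))"
      by (intro total_recursive_Cons[OF staged_total[OF F]] total_recursive_hd
          total_recursive_tl total_recursive_nth) auto
    \<comment> \<open>Here \<open>ys\<close> lists the counter, the accumulator, the stage, the
      recursion argument and then the parameters. \<open>?L\<close> rearranges them for
      \<open>G\<close> and drops the recursion argument.\<close>
    let ?L = "\<lambda>ys. hd (tl (tl ys)) # hd ys # (hd (tl ys) - 1) # tl (tl (tl (tl ys)))"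
    have G': "total_recursive (Suc (Suc (Suc (Suc m)))) (\<lambda>ys. G (hd (?L ys)) (tl (?L ys)))"
    proof (rule total_recursive_Cons[OF staged_total[OF G]])
      fix i assume "i < Suc (Suc m)"
      then consider "i = 0" | "i = 1" | j where "i = Suc (Suc j)" "j < m"
        by (metis One_nat_def Suc_less_eq not0_implies_Suc)
      then show "total_recursive (Suc (Suc (Suc (Suc m))))
          (\<lambda>xs. (hd xs # (hd (tl xs) - 1) # tl (tl (tl (tl xs)))) ! i)"
        by cases (auto intro!: total_recursive_var total_recursive_computable[OF computable_pred, simplified]
          total_recursive_tl total_recursive_nth)
    qed (auto intro: total_recursive_var)
    have "total_recursive (Suc (Suc (Suc (Suc m)))) (\<lambda>ys. ?h (hd ys) (hd (tl ys)) (tl (tl ys)))"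
      using G' by (intro total_recursive_if_eq_0 total_recursive_const total_recursive_var) simp_all
    then show "total_recursive (Suc (Suc m)) (\<lambda>xs. ?H (hd xs) (tl xs))"
      using a by (intro total_recursive_rec_nat[where h = ?h] total_recursive_var) simp_all
  next
    fix s s' xs y
    assume "length xs = Suc m" "?H s xs = Suc y" "s \<le> s'"
    then show "?H s' xs = Suc y" using mono[of s "tl xs" "hd xs" y s'] by (simp add: H)
  next
    fix xs :: "nat list" and y
    assume "length xs = Suc m"
    then obtain i zs where xs: "xs = i # zs" "length zs = m" by (auto simp: length_Suc_conv)
    have "evals (PrimRec f g) (i # zs) y \<longleftrightarrow> (\<exists>s. P s zs i = Suc y)"
    proof (induction i arbitrary: y)
      case 0
      have "evals (PrimRec f g) (0 # zs) y \<longleftrightarrow> evals f zs y"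
        by (metis evals_PrimRec_0 evals_elims(5))
      then show ?case using staged_evals[OF F xs(2)] by simp
    next
      case (Suc i)
      show ?case
      proof
        assume "evals (PrimRec f g) (Suc i # zs) y"
        then obtain r where r: "evals (PrimRec f g) (i # zs) r" "evals g (i # r # zs) y"
          by (rule evals_elims(6))
        obtain s where s: "P s zs i = Suc r" using Suc r(1) by blast
        obtain s' where s': "G s' (i # r # zs) = Suc y" using staged_evals[OF G] xs r(2) by auto
        have "P (max s s') zs i = Suc r" using mono[OF s, of "max s s'"] xs by simp
        moreover have "G (max s s') (i # r # zs) = Suc y" using staged_mono[OF G s', of "max s s'"] xs by simp
        ultimately have "P (max s s') zs (Suc i) = Suc y" by (simp add: P_Suc)
        then show "\<exists>s. P s zs (Suc i) = Suc y" by blast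
      next
        assume "\<exists>s. P s zs (Suc i) = Suc y"
        then obtain s where s: "P s zs (Suc i) = Suc y" by blast
        then obtain r where r: "P s zs i = Suc r" by (cases "P s zs i") (auto simp: P_Suc)
        then have "G s (i # r # zs) = Suc y" using s by (simp add: P_Suc)
        then have "evals g (i # r # zs) y" using staged_evals[OF G] xs by auto
        moreover have "evals (PrimRec f g) (i # zs) r" using Suc r by blast
        ultimately show "evals (PrimRec f g) (Suc i # zs) y" by (auto intro: evals_PrimRec_Suc)
      qed
    qed
    then show "evals (PrimRec f g) xs y \<longleftrightarrow> (\<exists>s. ?H s xs = Suc y)" unfolding H using xs by simp
  qed
qed

text \<open>The search for a zero has value \<open>1\<close> while it runs, \<open>0\<close> after it met an argument
  with no value yet, and \<open>k + 2\<close> after it found the zero \<open>k\<close>.\<close>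

definition zero_search :: "(nat \<Rightarrow> nat) \<Rightarrow> nat \<Rightarrow> nat" where
  "zero_search v = rec_nat 1 (\<lambda>i r. if r = 0 then 0 else if r - 1 = 0 then
     (if v i = 0 then 0 else if v i - 1 = 0 then Suc (Suc i) else 1) else r)"

text \<open>The values of \<open>v\<close> are read as shifted by one: 0 is a missing value, 1 a
  zero, and \<open>Suc (Suc w)\<close> a known positive value.\<close>

lemma zero_search_running: "zero_search v n = 1 \<longleftrightarrow> (\<forall>j<n. \<exists>w. v j = Suc (Suc w))"
  unfolding zero_search_def
proof (induction n)
  case (Suc n)
  have "(\<exists>w. v n = Suc (Suc w)) \<longleftrightarrow> v n \<noteq> 0 \<and> v n - 1 \<noteq> 0"
    by (cases "v n"; cases "v n - 1") auto
  with Suc show ?case by (auto simp: less_Suc_eq)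
qed simp

lemma zero_search_found:
  "zero_search v n = Suc (Suc k) \<longleftrightarrow> k < n \<and> v k = 1 \<and> (\<forall>j<k. \<exists>w. v j = Suc (Suc w))"
proof (induction n)
  case 0
  show ?case by (simp add: zero_search_def)
next
  case (Suc n)
  have step: "zero_search v (Suc n) = (if zero_search v n = 1
     then (if v n = 0 then 0 else if v n = 1 then Suc (Suc n) else 1) else zero_search v n)"
    unfolding zero_search_def by auto
  show ?case
  proof (cases "zero_search v n = 1")
    case True
    then have "\<forall>j<n. \<exists>w. v j = Suc (Suc w)" using zero_search_running by blast
    moreover from this have "\<not> (k < n \<and> v k = 1)" by fastforce
    ultimately show ?thesis using True unfolding step by (auto simp: less_Suc_eq)
  next
    case False
    then have "\<not> (\<forall>j<n. \<exists>w. v j = Suc (Suc w))" using zero_search_running by blast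
    then show ?thesis using False Suc unfolding step by (auto simp: less_Suc_eq)
  qed
qed

text \<open>The stage bounds both the length of the search and the time granted to each evaluation.
  Subtracting 1 turns the found state \<open>k + 2\<close> into \<open>Suc k\<close>, and the
  running and stuck states into 0.\<close>

lemma staged_Mu:
  assumes F: "staged (Suc m) f F"
  shows "staged m (Mu f) (\<lambda>s xs. zero_search (\<lambda>i. F s (i # xs)) s - 1)"
    (is "staged _ _ ?H")
  unfolding staged_def
proof (intro conjI allI impI)
  let ?h = "\<lambda>i r xs. if r = 0 then 0 else if r - 1 = 0 then
     (if F (hd xs) (i # tl xs) = 0 then 0 else if F (hd xs) (i # tl xs) - 1 = 0 then Suc (Suc i) else 1) else r"
  let ?L = "\<lambda>ys. hd (tl (tl ys)) # hd ys # tl (tl (tl ys))"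
  have "total_recursive (Suc (Suc (Suc m))) (\<lambda>ys. F (hd (?L ys)) (tl (?L ys)))"
  proof (rule total_recursive_Cons[OF staged_total[OF F]])
    fix i assume "i < Suc m"
    then show "total_recursive (Suc (Suc (Suc m))) (\<lambda>xs. (hd xs # tl (tl (tl xs))) ! i)"
      by (cases i) (auto intro!: total_recursive_var total_recursive_tl total_recursive_nth)
  qed (auto intro: total_recursive_var)
  then have "total_recursive (Suc (Suc (Suc m))) (\<lambda>ys. ?h (hd ys) (hd (tl ys)) (tl (tl ys)))"
    by (intro total_recursive_if_eq_0 total_recursive_const total_recursive_var
      total_recursive_computable[OF computable_pred] total_recursive_computable[OF computable_Suc]) simp_all
  then show "total_recursive (Suc m) (\<lambda>xs. ?H (hd xs) (tl xs))"
    unfolding zero_search_def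
    by (intro total_recursive_rec_nat[where h = ?h] total_recursive_var total_recursive_const
      total_recursive_computable[OF computable_pred])
next
  fix s s' xs y
  assume *: "length xs = m" "?H s xs = Suc y" "s \<le> s'"
  from *(2) have "zero_search (\<lambda>i. F s (i # xs)) s = Suc (Suc y)" by simp
  then have "y < s" "F s (y # xs) = 1" "\<forall>j<y. \<exists>w. F s (j # xs) = Suc (Suc w)"
    unfolding zero_search_found by blast+
  moreover have "F s' (j # xs) = Suc w" if "F s (j # xs) = Suc w" for j w
    by (rule staged_mono[OF F that *(3)]) (simp add: *(1))
  ultimately have "y < s'" "F s' (y # xs) = 1" "\<forall>j<y. \<exists>w. F s' (j # xs) = Suc (Suc w)"
    using *(3) by (linarith, metis One_nat_def, metis)
  then have "zero_search (\<lambda>i. F s' (i # xs)) s' = Suc (Suc y)"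
    unfolding zero_search_found by blast
  then show "?H s' xs = Suc y" by simp
next
  fix xs :: "nat list" and y
  assume len: "length xs = m"
  have "evals (Mu f) xs y \<longleftrightarrow> evals f (y # xs) 0 \<and> (\<forall>i<y. \<exists>v. evals f (i # xs) (Suc v))"
    by (rule iffI, erule evals_elims(8), simp, rule evals_Mu, simp_all)
  also have "\<dots> \<longleftrightarrow> (\<exists>s. F s (y # xs) = 1) \<and> (\<forall>i<y. \<exists>v s. F s (i # xs) = Suc (Suc v))"
    using staged_evals[OF F] len by simp
  also have "\<dots> \<longleftrightarrow> (\<exists>s. y < s \<and> F s (y # xs) = 1 \<and> (\<forall>i<y. \<exists>v. F s (i # xs) = Suc (Suc v)))"
    (is "?A \<longleftrightarrow> ?B")
  proof
    assume A: ?A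
    then obtain s where s: "F s (y # xs) = 1" by blast
    have "\<exists>s. \<forall>i<y. \<exists>v. F s (i # xs) = Suc (Suc v)"
    proof (rule bounded_monotone_choice)
      show "\<exists>s v. F s (i # xs) = Suc (Suc v)" if "i < y" for i using A that by blast
      show "\<exists>v. F s' (i # xs) = Suc (Suc v)" if "\<exists>v. F s (i # xs) = Suc (Suc v)" "s \<le> s'" for i s s'
        using that staged_mono[OF F, of s "i # xs" _ s'] len by (metis length_Cons)
    qed
    then obtain s' where s': "\<forall>i<y. \<exists>v. F s' (i # xs) = Suc (Suc v)" by blast
    let ?t = "max (Suc y) (max s s')"
    have "F ?t (y # xs) = 1" using staged_mono[OF F, of s "y # xs" 0 ?t] s len by simp
    moreover have "\<exists>v. F ?t (i # xs) = Suc (Suc v)" if i: "i < y" for i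
    proof -
      obtain v where "F s' (i # xs) = Suc (Suc v)" using s' i by blast
      then have "F ?t (i # xs) = Suc (Suc v)" by (rule staged_mono[OF F]) (simp_all add: len)
      then show ?thesis ..
    qed
    ultimately show ?B by (intro exI[of _ ?t]) auto
  qed blast
  also have "\<dots> \<longleftrightarrow> (\<exists>s. zero_search (\<lambda>i. F s (i # xs)) s = Suc (Suc y))"
    unfolding zero_search_found ..
  also have "\<dots> \<longleftrightarrow> (\<exists>s. ?H s xs = Suc y)"
    by (intro ex_cong1) auto
  finally show "evals (Mu f) xs y \<longleftrightarrow> (\<exists>s. ?H s xs = Suc y)" .
qed

text \<open>Programs carry no arity, so the induction is over all \<open>m\<close>. Where
  \<open>m\<close> is too small for the outermost constructor, the program diverges and is staged by
  the constant 0.\<close>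

lemma staged_exists: "\<exists>F. staged m r F"
proof (induction r arbitrary: m)
  case Zero
  have "staged m Zero (\<lambda>_ xs. Suc 0)"
    by (rule staged_total_recursive[OF total_recursive_const])
       (auto intro: evals_Zero elim: evals_elims(1))
  then show ?case by blast
next
  case Succ
  show ?case
  proof (cases m)
    case 0
    have "staged m Succ (\<lambda>_ _. 0)"
      by (rule staged_divergent) (auto simp: 0 elim: evals_elims(2))
    then show ?thesis by blast
  next
    case (Suc k)
    have "staged m Succ (\<lambda>_ xs. Suc (Suc (hd xs)))"
      unfolding Suc
      by (rule staged_total_recursive)
         (auto simp: length_Suc_conv intro!: evals_Succ total_recursive_hd
           total_recursive_computable[OF computable_Suc] elim: evals_elims(2))
    then show ?thesis by blast
  qed
next
  case (Proj i)
  show ?case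
  proof (cases "i < m")
    case False
    have "staged m (Proj i) (\<lambda>_ _. 0)"
      by (rule staged_divergent) (use False in \<open>auto elim: evals_elims(3)\<close>)
    then show ?thesis by blast
  next
    case True
    have "staged m (Proj i) (\<lambda>_ xs. Suc (xs ! i))"
      by (rule staged_total_recursive[OF total_recursive_nth])
         (use True in \<open>auto intro: evals_Proj elim: evals_elims(3)\<close>)
    then show ?thesis by blast
  qed
next
  case (Comp f gs)
  obtain F where "staged (length gs) f F" using Comp(1) by blast
  moreover have "\<forall>g\<in>set gs. \<exists>G. staged m g G" using Comp(2) by blast
  from bchoice[OF this] obtain G where "\<forall>g\<in>set gs. staged m g (G g)" by blast
  ultimately show ?case using staged_Comp[of gs f _ m G] by blast
next
  case (PrimRec f g)
  show ?case
  proof (cases m)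
    case 0
    have "staged m (PrimRec f g) (\<lambda>_ _. 0)"
      by (rule staged_divergent) (auto simp: 0 elim: evals_elims(7))
    then show ?thesis by blast
  next
    case (Suc k)
    obtain F where "staged k f F" using PrimRec(1) by blast
    moreover obtain G where "staged (Suc (Suc k)) g G" using PrimRec(2) by blast
    ultimately show ?thesis unfolding Suc using staged_PrimRec by blast
  qed
next
  case (Mu f)
  obtain F where "staged (Suc m) f F" using Mu by blast
  then show ?case using staged_Mu by blast
qed

section \<open>Computable functions and semidecidable relations\<close>

text \<open>Counter, accumulator and parameter are packed into one number, so that the closure rules
  can be stated for unary functions.\<close>

lemma computable_rec_nat:
  assumes "computable n" and "computable a"
    and "computable (\<lambda>z. h (pfst z) (pfst (psnd z)) (psnd (psnd z)))"
  shows "computable (\<lambda>x. rec_nat (a x) (\<lambda>i r. h i r x) (n x))"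
proof -
  have "total_recursive 1 (\<lambda>xs. rec_nat (a (hd xs)) (\<lambda>i r. h i r (hd xs)) (n (hd xs)))"
  proof (rule total_recursive_rec_nat)
    have "total_recursive (Suc (Suc 1)) (\<lambda>xs. pair (hd xs) (pair (hd (tl xs)) (hd (tl (tl xs)))))"
      unfolding One_nat_def
      by (intro total_recursive_computable2[OF computable2_pair] total_recursive_var)
    from total_recursive_computable[OF assms(3) this]
    show "total_recursive (Suc (Suc 1)) (\<lambda>xs. h (hd xs) (hd (tl xs)) (hd (tl (tl xs))))" by simp
  qed (use assms in \<open>simp_all add: computable_iff_total_recursive\<close>)
  then show ?thesis by (simp add: computable_iff_total_recursive)
qed

lemma computable2_mult: "computable2 (*)"
proof -
  have "total_recursive 2 (\<lambda>xs. rec_nat 0 (\<lambda>_ r. r + hd (tl xs)) (hd xs))"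
    unfolding numeral_2_eq_2
    by (intro total_recursive_rec_nat total_recursive_var total_recursive_const
        total_recursive_computable2[OF computable2_add] total_recursive_tl)
  moreover have "rec_nat 0 (\<lambda>_ r. r + y) x = x * y" for x y :: nat
    by (induction x) auto
  ultimately show ?thesis by (simp add: computable2_iff_total_recursive)
qed

lemmas computable_basic =
  computable_id computable_const computable_compose[OF computable_Suc]
  computable2_compose[OF computable2_add] computable2_compose[OF computable2_diff]
  computable2_compose[OF computable2_mult] computable_compose[OF computable_pfst]
  computable_compose[OF computable_psnd] computable2_compose[OF computable2_pair]

lemma computable_uncurry:
  assumes "computable (\<lambda>z. h (pfst z) (psnd z))" "computable f" "computable g"
  shows "computable (\<lambda>x. h (f x) (g x))"
proof -
  have "computable (\<lambda>x. pair (f x) (g x))" using assms(2,3) by (intro computable_basic)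
  from computable_compose[OF assms(1) this] show ?thesis by simp
qed

lemma computable_power: "computable a \<Longrightarrow> computable b \<Longrightarrow> computable (\<lambda>x. a x ^ b x)"
proof -
  assume *: "computable a" "computable b"
  have "rec_nat 1 (\<lambda>_ r. r * y) x = y ^ x" for x y :: nat
    by (induction x) auto
  moreover have "computable (\<lambda>x. rec_nat 1 (\<lambda>_ r. r * a x) (b x))"
    by (intro computable_rec_nat computable_basic * computable_compose[OF *(1)])
  ultimately show ?thesis by simp
qed

section \<open>Decidable predicates\<close>

definition decidable :: "(nat \<Rightarrow> bool) \<Rightarrow> bool" where
  "decidable P \<longleftrightarrow> computable (\<lambda>x. of_bool (P x))"

lemma decidable_compose: "decidable P \<Longrightarrow> computable f \<Longrightarrow> decidable (\<lambda>x. P (f x))"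
  unfolding decidable_def by (rule computable_compose)

lemma decidable_compose2:
  "decidable (\<lambda>z. P (pfst z) (psnd z)) \<Longrightarrow> computable f \<Longrightarrow> computable g \<Longrightarrow> decidable (\<lambda>x. P (f x) (g x))"
  by (drule decidable_compose[of _ "\<lambda>x. pair (f x) (g x)"]) (auto intro: computable_basic)

lemma computable_if:
  assumes "decidable P" "computable a" "computable b"
  shows "computable (\<lambda>x. if P x then a x else b x)"
proof -
  have "computable (\<lambda>x. rec_nat (b x) (\<lambda>_ _. a x) (of_bool (P x)))"
    using assms unfolding decidable_def
    by (intro computable_rec_nat computable_basic computable_compose[OF assms(2)])
  moreover have "rec_nat (b x) (\<lambda>_ _. a x) (of_bool (P x)) = (if P x then a x else b x)" for x by simp
  ultimately show ?thesis by simp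
qed

lemma decidable_const: "decidable (\<lambda>_. c)"
  unfolding decidable_def by (rule computable_const)

lemma decidable_not:
  assumes "decidable P"
  shows "decidable (\<lambda>x. \<not> P x)"
proof -
  have "computable (\<lambda>x. 1 - of_bool (P x))"
    using assms unfolding decidable_def by (intro computable_basic)
  moreover have "1 - of_bool (P x) = (of_bool (\<not> P x) :: nat)" for x by simp
  ultimately show ?thesis unfolding decidable_def by simp
qed

lemma decidable_conj: "decidable P \<Longrightarrow> decidable Q \<Longrightarrow> decidable (\<lambda>x. P x \<and> Q x)"
  unfolding decidable_def of_bool_conj by (intro computable_basic)

lemma decidable_disj: "decidable P \<Longrightarrow> decidable Q \<Longrightarrow> decidable (\<lambda>x. P x \<or> Q x)"
  using decidable_not[OF decidable_conj[OF decidable_not[of P] decidable_not[of Q]]] by simp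

lemma decidable_le:
  assumes "computable a" "computable b"
  shows "decidable (\<lambda>x. a x \<le> b x)"
proof -
  have "computable (\<lambda>x. 1 - (a x - b x))" by (intro computable_basic assms)
  moreover have "1 - (a x - b x) = of_bool (a x \<le> b x)" for x by auto
  ultimately show ?thesis unfolding decidable_def by simp
qed

lemma decidable_less: "computable a \<Longrightarrow> computable b \<Longrightarrow> decidable (\<lambda>x. a x < b x)"
  using decidable_not[OF decidable_le[of b a]] by (simp add: not_le)

lemma decidable_eq: "computable a \<Longrightarrow> computable b \<Longrightarrow> decidable (\<lambda>x. a x = b x)"
  using decidable_conj[OF decidable_le[of a b] decidable_le[of b a]] by (simp add: order_eq_iff)

lemma decidable_ex_less:
  assumes "decidable (\<lambda>z. P (pfst z) (psnd z))" "computable n"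
  shows "decidable (\<lambda>x. \<exists>i<n x. P i x)"
proof -
  have "computable (\<lambda>x. rec_nat 0 (\<lambda>i r. if P i x then 1 else r) (n x))"
    by (intro computable_rec_nat computable_basic computable_if decidable_compose2[OF assms(1)] assms(2))
  moreover have "rec_nat (0::nat) (\<lambda>i r. if P i x then 1 else r) m = of_bool (\<exists>i<m. P i x)" for x m
    by (induction m) (auto simp: less_Suc_eq)
  ultimately show ?thesis unfolding decidable_def by (simp only:)
qed

lemma decidable_all_less:
  assumes "decidable (\<lambda>z. P (pfst z) (psnd z))" "computable n"
  shows "decidable (\<lambda>x. \<forall>i<n x. P i x)"
  using decidable_not[OF decidable_ex_less[OF decidable_not[OF assms(1)] assms(2)]] by simp

text \<open>Recursion on the dividend: the quotient grows when the next multiple of \<open>b\<close>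
  is reached. The guard \<open>0 < b\<close> reproduces the convention
  \<open>a div 0 = 0\<close>.\<close>

lemma computable_div:
  assumes "computable a" "computable b"
  shows "computable (\<lambda>x. a x div b x)"
proof -
  have "rec_nat 0 (\<lambda>i r. if Suc r * b \<le> Suc i \<and> 0 < b then Suc r else r) a = a div b" for a b :: nat
  proof (induction a)
    case (Suc a)
    have "Suc (a div b) * b \<le> Suc a \<longleftrightarrow> Suc a mod b = 0" if "0 < b"
    proof -
      have "Suc a div b = (if Suc a mod b = 0 then Suc (a div b) else a div b)"
        by (simp add: div_Suc)
      then show ?thesis using that
        by (metis Suc_n_not_le_n div_mult_mod_eq div_times_less_eq_dividend less_eq_div_iff_mult_less_eq order_refl)
    qed
    with Suc show ?case by (cases "b = 0") (auto simp: div_Suc)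
  qed simp
  moreover have "computable (\<lambda>x. rec_nat 0 (\<lambda>i r. if Suc r * b x \<le> Suc i \<and> 0 < b x then Suc r else r) (a x))"
    by (intro computable_rec_nat computable_if decidable_conj decidable_le decidable_less computable_basic assms
      computable_compose[OF assms(2)])
  ultimately show ?thesis by (simp only:)
qed

lemma computable_mod:
  assumes "computable a" "computable b"
  shows "computable (\<lambda>x. a x mod b x)"
  unfolding modulo_nat_def by (intro computable_basic computable_div assms)

section \<open>Semidecidable predicates as projections of decidable ones\<close>

definition semidecidable :: "(nat \<Rightarrow> bool) \<Rightarrow> bool" where
  "semidecidable P \<longleftrightarrow>
     (\<exists>R. decidable (\<lambda>z. R (pfst z) (psnd z)) \<and> (\<forall>x. P x \<longleftrightarrow> (\<exists>s. R s x)))"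

lemma semidecidableI:
  "decidable (\<lambda>z. R (pfst z) (psnd z)) \<Longrightarrow> (\<And>x. P x \<longleftrightarrow> (\<exists>s. R s x)) \<Longrightarrow> semidecidable P"
  unfolding semidecidable_def by blast

lemma semidecidableE:
  assumes "semidecidable P"
  obtains R where "decidable (\<lambda>z. R (pfst z) (psnd z))" "\<And>x. P x \<longleftrightarrow> (\<exists>s. R s x)"
  using assms unfolding semidecidable_def by blast

lemma semidecidable_decidable: "decidable P \<Longrightarrow> semidecidable P"
  by (rule semidecidableI[where R = "\<lambda>_. P"]) (auto intro: decidable_compose[OF _ computable_psnd])

lemma semidecidable_compose:
  assumes "semidecidable P" "computable f"
  shows "semidecidable (\<lambda>x. P (f x))"
proof -
  obtain R where R: "decidable (\<lambda>z. R (pfst z) (psnd z))" "\<And>x. P x \<longleftrightarrow> (\<exists>s. R s x)"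
    using assms(1) by (rule semidecidableE) blast
  show ?thesis
    by (rule semidecidableI[where R = "\<lambda>s x. R s (f x)"])
       (intro decidable_compose2[OF R(1)] computable_basic computable_compose[OF assms(2)], rule R(2))
qed

lemma semidecidable_compose2:
  "semidecidable (\<lambda>z. P (pfst z) (psnd z)) \<Longrightarrow> computable f \<Longrightarrow> computable g \<Longrightarrow>
   semidecidable (\<lambda>x. P (f x) (g x))"
  by (drule semidecidable_compose[of _ "\<lambda>x. pair (f x) (g x)"]) (auto intro: computable_basic)

lemma semidecidable_conj:
  assumes "semidecidable P" "semidecidable Q"
  shows "semidecidable (\<lambda>x. P x \<and> Q x)"
proof -
  obtain R where R: "decidable (\<lambda>z. R (pfst z) (psnd z))" "\<And>x. P x \<longleftrightarrow> (\<exists>s. R s x)"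
    using assms(1) by (rule semidecidableE) blast
  obtain S where S: "decidable (\<lambda>z. S (pfst z) (psnd z))" "\<And>x. Q x \<longleftrightarrow> (\<exists>s. S s x)"
    using assms(2) by (rule semidecidableE) blast
  show ?thesis
  proof (rule semidecidableI[where R = "\<lambda>s x. R (pfst s) x \<and> S (psnd s) x"])
    show "P x \<and> Q x \<longleftrightarrow> (\<exists>s. R (pfst s) x \<and> S (psnd s) x)" for x
      unfolding R(2) S(2) by (metis pfst_pair psnd_pair)
  qed (intro decidable_conj decidable_compose2[OF R(1)] decidable_compose2[OF S(1)] computable_basic)
qed

lemma semidecidable_disj:
  assumes "semidecidable P" "semidecidable Q"
  shows "semidecidable (\<lambda>x. P x \<or> Q x)"
proof -
  obtain R where R: "decidable (\<lambda>z. R (pfst z) (psnd z))" "\<And>x. P x \<longleftrightarrow> (\<exists>s. R s x)"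
    using assms(1) by (rule semidecidableE) blast
  obtain S where S: "decidable (\<lambda>z. S (pfst z) (psnd z))" "\<And>x. Q x \<longleftrightarrow> (\<exists>s. S s x)"
    using assms(2) by (rule semidecidableE) blast
  show ?thesis
  proof (rule semidecidableI[where R = "\<lambda>s x. R s x \<or> S s x"])
    show "P x \<or> Q x \<longleftrightarrow> (\<exists>s. R s x \<or> S s x)" for x
      unfolding R(2) S(2) by blast
  qed (intro decidable_disj R(1) S(1))
qed

lemma semidecidable_ex:
  assumes "semidecidable (\<lambda>z. P (pfst z) (psnd z))"
  shows "semidecidable (\<lambda>x. \<exists>y. P y x)"
proof -
  obtain R where R: "decidable (\<lambda>z. R (pfst z) (psnd z))"
      "\<And>z. P (pfst z) (psnd z) \<longleftrightarrow> (\<exists>s. R s z)"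
    using assms(1) by (rule semidecidableE) blast
  show ?thesis
  proof (rule semidecidableI[where R = "\<lambda>s x. R (pfst s) (pair (psnd s) x)"])
    have "P y x \<longleftrightarrow> (\<exists>s. R s (pair y x))" for y x
      using R(2)[of "pair y x"] by simp
    then show "(\<exists>y. P y x) \<longleftrightarrow> (\<exists>s. R (pfst s) (pair (psnd s) x))" for x
      by (metis pfst_pair psnd_pair)
  qed (intro decidable_compose2[OF R(1)] computable_basic)
qed

text \<open>One bound \<open>s\<close> covers the witnesses of all \<open>y < n x\<close>. As
  \<open>R\<close> need not be monotone in its stage, the witness is searched below \<open>s\<close>
  instead of being \<open>s\<close> itself.\<close>

lemma semidecidable_all_less:
  assumes "semidecidable (\<lambda>z. P (pfst z) (psnd z))" "computable n"
  shows "semidecidable (\<lambda>x. \<forall>y<n x. P y x)"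
proof -
  obtain R where R: "decidable (\<lambda>z. R (pfst z) (psnd z))"
      "\<And>z. P (pfst z) (psnd z) \<longleftrightarrow> (\<exists>s. R s z)"
    using assms(1) by (rule semidecidableE) blast
  show ?thesis
  proof (rule semidecidableI[where R = "\<lambda>s x. \<forall>y<n x. \<exists>t<s. R t (pair y x)"])
    fix x
    have P: "P y x \<longleftrightarrow> (\<exists>s. R s (pair y x))" for y
      using R(2)[of "pair y x"] by simp
    show "(\<forall>y<n x. P y x) \<longleftrightarrow> (\<exists>s. \<forall>y<n x. \<exists>t<s. R t (pair y x))"
    proof
      assume *: "\<forall>y<n x. P y x"
      show "\<exists>s. \<forall>y<n x. \<exists>t<s. R t (pair y x)"
      proof (rule bounded_monotone_choice)
        show "\<exists>s. \<exists>t<s. R t (pair y x)" if "y < n x" for y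
          using * that P by (meson lessI)
      qed (meson less_le_trans)
    qed (use P in blast)
  qed (intro decidable_all_less decidable_ex_less decidable_compose2[OF R(1)] computable_basic
      computable_compose[OF assms(2)])
qed

lemma semidecidable_ex_finite:
  "finite I \<Longrightarrow> (\<And>i. i \<in> I \<Longrightarrow> semidecidable (P i)) \<Longrightarrow> semidecidable (\<lambda>x. \<exists>i\<in>I. P i x)"
  by (induction rule: finite_induct)
     (auto intro: semidecidable_disj semidecidable_decidable decidable_const)

lemma semidecidable_all_finite:
  "finite I \<Longrightarrow> (\<And>i. i \<in> I \<Longrightarrow> semidecidable (P i)) \<Longrightarrow> semidecidable (\<lambda>x. \<forall>i\<in>I. P i x)"
  by (induction rule: finite_induct)
     (auto intro: semidecidable_conj semidecidable_decidable decidable_const)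

text \<open>A number codes the sequence of the first components of its iterated second components.\<close>

definition entry :: "nat \<Rightarrow> nat \<Rightarrow> nat" where
  "entry c i = pfst ((psnd ^^ i) c)"

lemma computable_entry:
  assumes "computable a" "computable b"
  shows "computable (\<lambda>x. entry (a x) (b x))"
proof -
  have "rec_nat c (\<lambda>_ r. psnd r) i = (psnd ^^ i) c" for c i
    by (induction i) auto
  moreover have "computable (\<lambda>x. pfst (rec_nat (a x) (\<lambda>_ r. psnd r) (b x)))"
    by (intro computable_basic computable_rec_nat assms)
  ultimately show ?thesis unfolding entry_def by simp
qed

lemma entry_surj: "\<exists>c. \<forall>i\<le>n. entry c i = f i"
proof (induction n arbitrary: f)
  case 0
  have "entry (pair (f 0) 0) 0 = f 0" by (simp add: entry_def)
  then show ?case by auto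
next
  case (Suc n)
  obtain c where c: "\<forall>i\<le>n. entry c i = f (Suc i)" using Suc[of "\<lambda>i. f (Suc i)"] by blast
  have "entry (pair (f 0) c) i = f i" if "i \<le> Suc n" for i
    using c that by (cases i) (auto simp: entry_def funpow_Suc_right simp del: funpow.simps)
  then show ?case by blast
qed

text \<open>Chains with an arbitrary start. The base case is \<open>True\<close> because it will
  index the empty intersection, that is, the whole space as the union of all basis sets.\<close>

primrec iterate :: "(nat \<Rightarrow> nat \<Rightarrow> nat \<Rightarrow> bool) \<Rightarrow> nat \<Rightarrow> nat \<Rightarrow> bool" where
  "iterate R 0 l \<longleftrightarrow> True"
| "iterate R (Suc y) l \<longleftrightarrow> (\<exists>m. iterate R y m \<and> R y m l)"

lemma iterate_iff_ex_sequence: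
  "iterate R y l \<longleftrightarrow> (\<exists>f. f y = l \<and> (\<forall>i<y. R i (f i) (f (Suc i))))"
proof (induction y arbitrary: l)
  case 0
  show ?case by auto
next
  case (Suc y)
  show ?case
  proof
    assume "iterate R (Suc y) l"
    then obtain f where f: "\<forall>i<y. R i (f i) (f (Suc i))" "R y (f y) l" using Suc by auto
    then show "\<exists>f. f (Suc y) = l \<and> (\<forall>i<Suc y. R i (f i) (f (Suc i)))"
      by (intro exI[of _ "f(Suc y := l)"]) (auto simp: less_Suc_eq)
  next
    assume "\<exists>f. f (Suc y) = l \<and> (\<forall>i<Suc y. R i (f i) (f (Suc i)))"
    then obtain f where f: "f (Suc y) = l" "\<forall>i<Suc y. R i (f i) (f (Suc i))" by blast
    then have "iterate R y (f y)" unfolding Suc by (intro exI[of _ f]) simp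
    with f show "iterate R (Suc y) l" by auto
  qed
qed

text \<open>The length of the chain varies with \<open>z\<close>, so the chain is coded by a single
  number \<open>c\<close>, over which an unbounded search is made.\<close>

lemma semidecidable_iterate:
  assumes R: "semidecidable (\<lambda>z. R (pfst z) (pfst (psnd z)) (pfst (psnd (psnd z))) (psnd (psnd (psnd z))))"
    and "computable n" "computable l"
  shows "semidecidable (\<lambda>z. iterate (R z) (n z) (l z))"
proof -
  have eq: "iterate (R z) y l \<longleftrightarrow> (\<exists>c. entry c y = l \<and> (\<forall>i<y. R z i (entry c i) (entry c (Suc i))))" for z y l
  proof
    assume "iterate (R z) y l"
    then obtain f where f: "f y = l" "\<forall>i<y. R z i (f i) (f (Suc i))"
      unfolding iterate_iff_ex_sequence by blast
    obtain c where c: "\<forall>i\<le>y. entry c i = f i" using entry_surj by blast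
    show "\<exists>c. entry c y = l \<and> (\<forall>i<y. R z i (entry c i) (entry c (Suc i)))"
      by (rule exI[of _ c]) (use f c in auto)
  qed (auto simp: iterate_iff_ex_sequence)
  have R': "semidecidable (\<lambda>x. R (f x) (g x) (h x) (k x))"
    if "computable f" "computable g" "computable h" "computable k" for f g h k
  proof -
    have "computable (\<lambda>x. pair (f x) (pair (g x) (pair (h x) (k x))))"
      using that by (intro computable_basic)
    from semidecidable_compose[OF R this] show ?thesis by simp
  qed
  show ?thesis
    unfolding eq
    by (intro semidecidable_ex semidecidable_conj semidecidable_all_less semidecidable_decidable[OF decidable_eq]
      R' computable_entry computable_basic computable_compose[OF assms(2)] computable_compose[OF assms(3)])
qed

lemma semidecidable_graph:
  assumes "partial_computable2 \<psi>"
  shows "semidecidable (\<lambda>z. \<psi> (pfst z) (pfst (psnd z)) = Some (psnd (psnd z)))"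
proof -
  obtain r where r: "\<And>x1 x2 y. \<psi> x1 x2 = Some y \<longleftrightarrow> evals r [x1, x2] y"
    using assms unfolding partial_computable2_def by blast
  obtain F where F: "staged 2 r F" using staged_exists by blast
  have "total_recursive 1 (\<lambda>xs. [pfst (hd xs), pfst (psnd (hd xs)), pfst (psnd (psnd (hd xs)))] ! i)" if "i < 3" for i
  proof -
    have "i = 0 \<or> i = 1 \<or> i = 2" using that by auto
    then show ?thesis
      by (auto intro!: total_recursive_computable[OF computable_pfst] total_recursive_hd
        total_recursive_computable[OF computable_psnd])
  qed
  with total_recursive_compose[OF staged_total[OF F], of 1
      "\<lambda>xs. [pfst (hd xs), pfst (psnd (hd xs)), pfst (psnd (psnd (hd xs)))]"]
  have "computable (\<lambda>w. F (pfst w) [pfst (psnd w), pfst (psnd (psnd w))])"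
    by (simp add: computable_iff_total_recursive)
  then have "decidable (\<lambda>w. F (pfst w) [pfst (psnd w), pfst (psnd (psnd w))] = Suc (psnd (psnd (psnd w))))"
    by (intro decidable_eq computable_basic)
  then show ?thesis
    by (rule semidecidableI[where R = "\<lambda>s z. F s [pfst z, pfst (psnd z)] = Suc (psnd (psnd z))"])
       (simp add: r staged_evals[OF F])
qed

text \<open>\<open>Mu\<close> searches through pairs \<open>w\<close> of a stage and a candidate
  value, and \<open>q\<close> then extracts the value. Since \<open>\<psi>\<close> is a function,
  any accepted candidate is the right one. The characteristic function is inverted because
  \<open>Mu\<close> looks for zeros.\<close>

lemma partial_computable2_semidecidable_graph:
  assumes "semidecidable (\<lambda>z. \<psi> (pfst z) (pfst (psnd z)) = Some (psnd (psnd z)))"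
  shows "partial_computable2 \<psi>"
proof -
  obtain R where R: "decidable (\<lambda>w. R (pfst w) (psnd w))"
      "\<And>z. \<psi> (pfst z) (pfst (psnd z)) = Some (psnd (psnd z)) \<longleftrightarrow> (\<exists>s. R s z)"
    using assms by (rule semidecidableE) blast
  define f where "f w x1 x2 = (1::nat) - of_bool (R (pfst w) (pair x1 (pair x2 (psnd w))))" for w x1 x2
  have "total_recursive (Suc (Suc (Suc 0))) (\<lambda>xs. pair (pfst (hd xs)) (pair (hd (tl xs)) (pair (hd (tl (tl xs))) (psnd (hd xs)))))"
    by (intro total_recursive_computable2[OF computable2_pair] total_recursive_var
      total_recursive_computable[OF computable_pfst] total_recursive_computable[OF computable_psnd])
  moreover have "computable (\<lambda>w. 1 - of_bool (R (pfst w) (psnd w)))"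
    using R(1) unfolding decidable_def by (intro computable_basic)
  ultimately have "total_recursive (Suc (Suc (Suc 0))) (\<lambda>xs. f (hd xs) (hd (tl xs)) (hd (tl (tl xs))))"
    using total_recursive_computable unfolding f_def by fastforce
  then obtain p where p: "\<And>xs. length xs = Suc (Suc (Suc 0)) \<Longrightarrow> evals p xs (f (hd xs) (hd (tl xs)) (hd (tl (tl xs))))"
    unfolding total_recursive_def by blast
  have p: "evals p [w, x1, x2] (f w x1 x2)" for w x1 x2
    using p[of "[w, x1, x2]"] by simp
  obtain q where q: "\<And>x y. psnd x = y \<longleftrightarrow> evals q [x] y"
    using computable_psnd unfolding computable_def partial_computable_def by auto
  have "\<psi> x1 x2 = Some y \<longleftrightarrow> evals (Comp q [Mu p]) [x1, x2] y" for x1 x2 y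
  proof
    assume "\<psi> x1 x2 = Some y"
    then obtain s where "R s (pair x1 (pair x2 y))" using R(2)[of "pair x1 (pair x2 y)"] by auto
    then have "f (pair s y) x1 x2 = 0" by (simp add: f_def)
    then have ex: "\<exists>w. f w x1 x2 = 0" by blast
    define w where "w = (LEAST w. f w x1 x2 = 0)"
    have w: "f w x1 x2 = 0" unfolding w_def using ex by (rule LeastI_ex)
    have "evals (Mu p) [x1, x2] w"
    proof (rule evals_Mu)
      show "evals p [w, x1, x2] 0" using p[of w x1 x2] w by simp
      show "\<exists>v. evals p [i, x1, x2] (Suc v)" if "i < w" for i
      proof -
        have "f i x1 x2 \<noteq> 0" using not_less_Least that unfolding w_def by blast
        then show ?thesis using p[of i x1 x2] by (metis not0_implies_Suc)
      qed
    qed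
    then have "evals (Comp q [Mu p]) [x1, x2] (psnd w)"
      using q by (intro evals_Comp[where ys = "[w]"]) auto
    moreover have "R (pfst w) (pair x1 (pair x2 (psnd w)))"
      using w by (simp add: f_def of_bool_def split: if_splits)
    then have "\<psi> x1 x2 = Some (psnd w)"
      using R(2)[of "pair x1 (pair x2 (psnd w))"] by auto
    ultimately show "evals (Comp q [Mu p]) [x1, x2] y"
      using \<open>\<psi> x1 x2 = Some y\<close> by simp
  next
    assume "evals (Comp q [Mu p]) [x1, x2] y"
    then obtain w where w: "evals (Mu p) [x1, x2] w" "evals q [w] y"
      by (rule evals_elims(4)) (auto simp: list_all2_Cons1)
    from w(1) have "evals p [w, x1, x2] 0" by (rule evals_elims(8))
    then have "f w x1 x2 = 0" using evals_deterministic[OF p] by blast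
    then have "R (pfst w) (pair x1 (pair x2 (psnd w)))"
      by (simp add: f_def of_bool_def split: if_splits)
    then have "\<psi> x1 x2 = Some (psnd w)"
      using R(2)[of "pair x1 (pair x2 (psnd w))"] by auto
    then show "\<psi> x1 x2 = Some y" using q[of w y] w(2) by simp
  qed
  then show ?thesis unfolding partial_computable2_def by blast
qed

section \<open>Acceptable numberings and effective open sets\<close>

locale acceptable_numbering =
  fixes \<phi> :: "nat \<Rightarrow> nat \<rightharpoonup> nat"
  assumes standard: "standard_enumeration \<phi>"
begin

lemma semidecidable_enumeration:
  assumes "computable e" "computable x" "computable y"
  shows "semidecidable (\<lambda>z. \<phi> (e z) (x z) = Some (y z))"
proof -
  have "computable (\<lambda>z. pair (e z) (pair (x z) (y z)))" using assms by (intro computable_basic)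
  moreover have "partial_computable2 \<phi>" using standard unfolding standard_enumeration_def by blast
  ultimately show ?thesis using semidecidable_compose[OF semidecidable_graph] by fastforce
qed

lemma semidecidable_W:
  assumes "computable e" "computable i"
  shows "semidecidable (\<lambda>z. i z \<in> W \<phi> (e z))"
proof -
  have "semidecidable (\<lambda>z. \<exists>y. \<phi> (e z) (i z) = Some y)"
    by (intro semidecidable_ex semidecidable_enumeration computable_basic
      computable_compose[OF assms(1)] computable_compose[OF assms(2)])
  then show ?thesis by (simp add: W_def dom_def)
qed

lemma parameter_theorem:
  assumes "semidecidable (\<lambda>z. \<psi> (pfst z) (pfst (psnd z)) = Some (psnd (psnd z)))"
  obtains s where "computable s" "\<And>e. \<phi> (s e) = \<psi> e"
  using standard partial_computable2_semidecidable_graph[OF assms]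
  unfolding standard_enumeration_def by blast

lemma index_of_semidecidable:
  assumes "semidecidable (\<lambda>z. P (pfst z) (psnd z))"
  obtains h where "computable h" "\<And>k. W \<phi> (h k) = {i. P k i}"
proof -
  define \<psi> where "\<psi> k i = (if P k i then Some (0::nat) else None)" for k i
  have "\<psi> k i = Some y \<longleftrightarrow> P k i \<and> y = 0" for k i y by (auto simp: \<psi>_def)
  moreover have "semidecidable (\<lambda>z. P (pfst z) (pfst (psnd z)) \<and> psnd (psnd z) = 0)"
    by (intro semidecidable_conj semidecidable_compose2[OF assms] semidecidable_decidable[OF decidable_eq]
      computable_basic)
  ultimately have "semidecidable (\<lambda>z. \<psi> (pfst z) (pfst (psnd z)) = Some (psnd (psnd z)))" by simp
  then obtain s where s: "computable s" "\<And>e. \<phi> (s e) = \<psi> e" by (rule parameter_theorem) blast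
  have "W \<phi> (s k) = {i. P k i}" for k
    unfolding W_def s(2) by (auto simp: \<psi>_def split: if_splits)
  with s(1) show ?thesis by (rule that)
qed

lemma ce_set_iff_semidecidable: "ce_set \<phi> S \<longleftrightarrow> semidecidable (\<lambda>x. x \<in> S)"
proof
  assume "ce_set \<phi> S"
  then show "semidecidable (\<lambda>x. x \<in> S)"
    unfolding ce_set_def using semidecidable_W[OF computable_const computable_id] by auto
next
  assume "semidecidable (\<lambda>x. x \<in> S)"
  then have "semidecidable (\<lambda>z. psnd z \<in> S)" by (rule semidecidable_compose[OF _ computable_psnd])
  then obtain h where "\<And>k. W \<phi> (h k) = {i. i \<in> S}" by (rule index_of_semidecidable) blast
  then show "ce_set \<phi> S" unfolding ce_set_def by (metis Collect_mem_eq)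
qed

lemma index_of_computable:
  assumes "computable f"
  obtains v where "\<And>x. \<phi> v x = Some (f x)"
proof -
  have "(\<lambda>x. Some (f x)) \<in> range \<phi>"
    using assms standard unfolding computable_def standard_enumeration_def by blast
  then show ?thesis using that by (metis imageE)
qed

text \<open>Kleene's recursion theorem with a parameter: the program \<open>r p\<close> has access
  to its own index.\<close>

lemma recursion_theorem:
  assumes "semidecidable (\<lambda>z. \<psi> (pfst z) (pfst (psnd z)) (pfst (psnd (psnd z))) = Some (psnd (psnd (psnd z))))"
  obtains r where "computable r" "\<And>p. \<phi> (r p) = \<psi> (r p) p"
proof -
  have "computable (\<lambda>z. pair (pfst (pfst z)) (pair (psnd (pfst z)) (pair (pfst (psnd z)) (psnd (psnd z)))))"
    by (intro computable_basic)
  from semidecidable_compose[OF assms this]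
  obtain s where s: "computable s" "\<And>w. \<phi> (s w) = \<psi> (pfst w) (psnd w)"
    using parameter_theorem[where \<psi> = "\<lambda>w. \<psi> (pfst w) (psnd w)"] by auto
  have "semidecidable (\<lambda>z. \<exists>v. \<phi> (pfst (pfst z)) (pfst z) = Some v \<and> \<phi> v (pfst (psnd z)) = Some (psnd (psnd z)))"
    by (intro semidecidable_ex semidecidable_conj semidecidable_enumeration computable_basic)
  moreover have "Option.bind (\<phi> (pfst w) w) (\<lambda>v. \<phi> v x) = Some y \<longleftrightarrow>
      (\<exists>v. \<phi> (pfst w) w = Some v \<and> \<phi> v x = Some y)" for w x y
    by (simp add: bind_eq_Some_conv)
  ultimately have "semidecidable (\<lambda>z. Option.bind (\<phi> (pfst (pfst z)) (pfst z)) (\<lambda>v. \<phi> v (pfst (psnd z))) =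
      Some (psnd (psnd z)))" by simp
  then obtain d where d: "computable d" "\<And>w. \<phi> (d w) = (\<lambda>x. Option.bind (\<phi> (pfst w) w) (\<lambda>v. \<phi> v x))"
    by (rule parameter_theorem[where \<psi> = "\<lambda>w x. Option.bind (\<phi> (pfst w) w) (\<lambda>v. \<phi> v x)"]) blast
  \<comment> \<open>The program \<open>d w\<close> runs the program whose index
    \<open>pfst w\<close> computes from \<open>w\<close>. For \<open>v\<close> an index of this map
    and \<open>w = pair v p\<close>, that is the program \<open>s (pair (d w) p)\<close>, which
    computes \<open>\<psi> (d w) p\<close>.\<close>
  have "computable (\<lambda>w. s (pair (d w) (psnd w)))"
    by (intro computable_compose[OF s(1)] computable_basic d(1))
  then obtain v where v: "\<And>w. \<phi> v w = Some (s (pair (d w) (psnd w)))"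
    by (rule index_of_computable) blast
  show ?thesis
  proof
    show "computable (\<lambda>p. d (pair v p))" by (intro computable_compose[OF d(1)] computable_basic)
    show "\<phi> (d (pair v p)) = \<psi> (d (pair v p)) p" for p
      by (subst d(2)) (simp add: v s(2))
  qed
qed

end

section \<open>Closure properties of uniformly effective open sets\<close>

locale effective_space = acceptable_numbering +
  fixes X :: "'a topology" and B :: "nat \<Rightarrow> 'a set"
  assumes space: "effective_topological_space \<phi> X B"
begin

lemma Union_basis: "(\<Union>i. B i) = topspace X"
proof
  show "(\<Union>i. B i) \<subseteq> topspace X"
    using space openin_subset unfolding effective_topological_space_def by fastforce
  obtain I where "topspace X = (\<Union>i\<in>I. B i)"
    using space openin_topspace unfolding effective_topological_space_def by blast
  then show "topspace X \<subseteq> (\<Union>i. B i)" by blast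
qed

lemma computable_basis_Int:
  obtains g where "computable2 g" "\<And>i j. B i \<inter> B j = (\<Union>k\<in>W \<phi> (g i j). B k)"
  using space unfolding effective_topological_space_def by blast

text \<open>A semidecidable relation replaces the computable index function, so that bound variables
  can be paired with the parameter and closure proofs reduce to those for semidecidability.\<close>

definition effective_family :: "(nat \<Rightarrow> 'a set) \<Rightarrow> bool" where
  "effective_family U \<longleftrightarrow>
     (\<exists>E. semidecidable (\<lambda>z. E (pfst z) (psnd z)) \<and> (\<forall>k. U k = (\<Union>i\<in>{i. E k i}. B i)))"

lemma effective_familyI:
  "semidecidable (\<lambda>z. E (pfst z) (psnd z)) \<Longrightarrow> (\<And>k. U k = (\<Union>i\<in>{i. E k i}. B i)) \<Longrightarrow> effective_family U"
  unfolding effective_family_def by blast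

lemma effective_familyE:
  assumes "effective_family U"
  obtains E where "semidecidable (\<lambda>z. E (pfst z) (psnd z))" "\<And>k. U k = (\<Union>i\<in>{i. E k i}. B i)"
  using assms unfolding effective_family_def by blast

lemma effective_family_uniformly_effective_open:
  assumes "effective_family U"
  shows "uniformly_effective_open \<phi> B U"
proof -
  obtain E where E: "semidecidable (\<lambda>z. E (pfst z) (psnd z))" "\<And>k. U k = (\<Union>i\<in>{i. E k i}. B i)"
    using assms by (rule effective_familyE) blast
  obtain h where "computable h" "\<And>k. W \<phi> (h k) = {i. E k i}"
    using E(1) by (rule index_of_semidecidable) blast
  then show ?thesis unfolding uniformly_effective_open_def E(2) by auto
qed

text \<open>The set is everything or nothing according to \<open>P k\<close>. Intersecting with it
  imposes a semidecidable side condition on an open set.\<close>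

lemma effective_family_semidecidable:
  assumes "semidecidable P"
  shows "effective_family (\<lambda>k. {x \<in> topspace X. P k})"
  by (rule effective_familyI[where E = "\<lambda>k i. P k"])
     (use Union_basis in \<open>auto intro: semidecidable_compose[OF assms computable_pfst]\<close>)

lemma effective_family_basis:
  assumes "computable b"
  shows "effective_family (\<lambda>k. B (b k))"
  by (rule effective_familyI[where E = "\<lambda>k i. i = b k"])
     (auto intro!: semidecidable_decidable decidable_eq computable_psnd computable_compose[OF assms computable_pfst])

lemma effective_family_Int:
  assumes "effective_family U" "effective_family V"
  shows "effective_family (\<lambda>k. U k \<inter> V k)"
proof -
  obtain E where E: "semidecidable (\<lambda>z. E (pfst z) (psnd z))" "\<And>k. U k = (\<Union>i\<in>{i. E k i}. B i)"
    using assms(1) by (rule effective_familyE) blast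
  obtain F where F: "semidecidable (\<lambda>z. F (pfst z) (psnd z))" "\<And>k. V k = (\<Union>i\<in>{i. F k i}. B i)"
    using assms(2) by (rule effective_familyE) blast
  obtain g where g: "computable2 g" "\<And>i j. B i \<inter> B j = (\<Union>k\<in>W \<phi> (g i j). B k)"
    by (rule computable_basis_Int) blast
  show ?thesis
  proof (rule effective_familyI[where E = "\<lambda>k l. \<exists>i j. E k i \<and> F k j \<and> l \<in> W \<phi> (g i j)"])
    show "semidecidable (\<lambda>z. \<exists>i j. E (pfst z) i \<and> F (pfst z) j \<and> psnd z \<in> W \<phi> (g i j))"
      by (intro semidecidable_ex semidecidable_conj semidecidable_compose2[OF E(1)]
        semidecidable_compose2[OF F(1)] semidecidable_W computable2_compose[OF g(1)] computable_basic)
    have "U k \<inter> V k = (\<Union>i\<in>{i. E k i}. \<Union>j\<in>{j. F k j}. B i \<inter> B j)" for k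
      unfolding E(2) F(2) by blast
    then show "U k \<inter> V k = (\<Union>l\<in>{l. \<exists>i j. E k i \<and> F k j \<and> l \<in> W \<phi> (g i j)}. B l)" for k
      unfolding g(2) by auto
  qed
qed

lemma effective_family_UN:
  assumes "effective_family (\<lambda>z. U (pfst z) (psnd z))"
  shows "effective_family (\<lambda>k. \<Union>y. U y k)"
proof -
  obtain E where E: "semidecidable (\<lambda>z. E (pfst z) (psnd z))"
      "\<And>z. U (pfst z) (psnd z) = (\<Union>i\<in>{i. E z i}. B i)"
    using assms by (rule effective_familyE) blast
  have U: "U y k = (\<Union>i\<in>{i. E (pair y k) i}. B i)" for y k using E(2)[of "pair y k"] by simp
  show ?thesis
  proof (rule effective_familyI[where E = "\<lambda>k i. \<exists>y. E (pair y k) i"])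
    show "semidecidable (\<lambda>z. \<exists>y. E (pair y (pfst z)) (psnd z))"
      by (intro semidecidable_ex semidecidable_compose2[OF E(1)] computable_basic)
  qed (auto simp: U)
qed

text \<open>The number of sets varies with \<open>k\<close>, so the intersection is described by
  chains of basis indices: each next index is listed for the intersection of the current basis set
  with some basis part of the next \<open>U y k\<close>.\<close>

lemma effective_family_INT_less:
  assumes "effective_family (\<lambda>z. U (pfst z) (psnd z))" "computable n"
  shows "effective_family (\<lambda>k. topspace X \<inter> (\<Inter>y<n k. U y k))"
proof -
  obtain E where E: "semidecidable (\<lambda>z. E (pfst z) (psnd z))"
      "\<And>z. U (pfst z) (psnd z) = (\<Union>i\<in>{i. E z i}. B i)"
    using assms(1) by (rule effective_familyE) blast
  have U: "U y k = (\<Union>i\<in>{i. E (pair y k) i}. B i)" for y k using E(2)[of "pair y k"] by simp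
  obtain g where g: "computable2 g" "\<And>i j. B i \<inter> B j = (\<Union>k\<in>W \<phi> (g i j). B k)"
    by (rule computable_basis_Int) blast
  define R where "R k y m l \<longleftrightarrow> (\<exists>j. E (pair y k) j \<and> l \<in> W \<phi> (g m j))" for k y m l
  show ?thesis
  proof (rule effective_familyI[where E = "\<lambda>k l. iterate (R k) (n k) l"])
    show "semidecidable (\<lambda>z. iterate (R (pfst z)) (n (pfst z)) (psnd z))"
      unfolding R_def
      by (intro semidecidable_iterate semidecidable_ex semidecidable_conj semidecidable_compose2[OF E(1)]
        semidecidable_W computable2_compose[OF g(1)] computable_basic computable_compose[OF assms(2)])
    have "topspace X \<inter> (\<Inter>y<m. U y k) = (\<Union>l\<in>{l. iterate (R k) m l}. B l)" for k m
    proof (induction m)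
      case 0
      show ?case using Union_basis by simp
    next
      case (Suc m)
      have "topspace X \<inter> (\<Inter>y<Suc m. U y k) = (topspace X \<inter> (\<Inter>y<m. U y k)) \<inter> U m k"
        by (auto simp: lessThan_Suc)
      also have "\<dots> = (\<Union>i\<in>{l. iterate (R k) m l}. \<Union>j\<in>{j. E (pair m k) j}. B i \<inter> B j)"
        unfolding Suc unfolding U by blast
      also have "\<dots> = (\<Union>l\<in>{l. iterate (R k) (Suc m) l}. B l)"
        unfolding g(2) by (auto simp: R_def)
      finally show ?case .
    qed
    then show "topspace X \<inter> (\<Inter>y<n k. U y k) = (\<Union>l\<in>{l. iterate (R k) (n k) l}. B l)" for k .
  qed
qed

end

section \<open>Difference hierarchies\<close>

lemma mem_D_iff:
  "x \<in> D n S \<longleftrightarrow> (\<exists>i\<in>{1..n}. odd i \<and> x \<in> S i \<and> (i < n \<longrightarrow> x \<notin> S (i + 1)))"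
  unfolding D_def by (auto split: if_splits)

text \<open>Only \<open>i = m\<close> can witness membership: for smaller \<open>i\<close> the point
  also lies in \<open>S (i + 1)\<close>, and for larger \<open>i\<close> it is not in
  \<open>S i\<close>.\<close>

lemma D_downward_closed:
  assumes "m \<le> n" and "\<And>i. i \<in> {1..n} \<Longrightarrow> x \<in> S i \<longleftrightarrow> i \<le> m"
  shows "x \<in> D n S \<longleftrightarrow> odd m"
proof -
  have "i \<in> {1..n} \<and> odd i \<and> x \<in> S i \<and> (i < n \<longrightarrow> x \<notin> S (i + 1)) \<longleftrightarrow> i = m \<and> odd m" for i
    using assms(1) assms(2)[of i] assms(2)[of "i + 1"]
    by (cases "i = m") (auto simp: Suc_le_eq dest: odd_pos)
  then show ?thesis unfolding mem_D_iff by blast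
qed

text \<open>For a decreasing family, counting the sets that contain a point determines which ones
  they are, so only the count needs to be monitored.\<close>

lemma card_nested:
  assumes "\<forall>i\<in>{1..<n}. S (i + 1) \<subseteq> S i" "i \<in> {1..n}"
  shows "x \<in> S i \<longleftrightarrow> i \<le> card {i \<in> {1..n}. x \<in> S i}"
proof -
  let ?I = "{i \<in> {1..n}. x \<in> S i}"
  have sub: "S j \<subseteq> S i" if "i \<le> j" "1 \<le> i" "j \<le> n" for i j
    using that
  proof (induction j rule: dec_induct)
    case (step j)
    then have "S (j + 1) \<subseteq> S j" using assms(1) by auto
    with step show ?case by auto
  qed simp
  show ?thesis
  proof
    assume "x \<in> S i"
    then have "{1..i} \<subseteq> ?I" using sub[of _ i] assms(2) by fastforce
    then show "i \<le> card ?I" using card_mono[of ?I "{1..i}"] by simp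
  next
    assume le: "i \<le> card ?I"
    show "x \<in> S i"
    proof (rule ccontr)
      assume "x \<notin> S i"
      have "?I \<subseteq> {1..<i}"
      proof
        fix j assume j: "j \<in> ?I"
        then have "\<not> i \<le> j" using sub[of i j] \<open>x \<notin> S i\<close> assms(2) by auto
        then show "j \<in> {1..<i}" using j by auto
      qed
      then have "card ?I \<le> i - 1" using card_mono[of "{1..<i}" ?I] by simp
      then show False using le assms(2) by auto
    qed
  qed
qed

text \<open>Turns arbitrary sets into nested ones with the same \<open>D\<close>: \<open>F\<close> is the set of indices of the
  sets a point belongs to, and \<open>weight n F\<close> is the largest number of times that membership
  in \<open>D\<close> can change while the point enters these sets one after another.\<close>

definition weight :: "nat \<Rightarrow> nat set \<Rightarrow> nat" where
  "weight n F = 2 * card {i. odd i \<and> i < n \<and> i \<in> F \<and> i + 1 \<in> F} +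
     of_bool (\<exists>i\<in>{1..n}. odd i \<and> i \<in> F \<and> (i < n \<longrightarrow> i + 1 \<notin> F))"

lemma odd_weight_iff: "odd (weight n F) \<longleftrightarrow> (\<exists>i\<in>{1..n}. odd i \<and> i \<in> F \<and> (i < n \<longrightarrow> i + 1 \<notin> F))"
  unfolding weight_def by simp

lemma weight_mono:
  assumes "F \<subseteq> G"
  shows "weight n F \<le> weight n G"
proof -
  let ?P = "\<lambda>F. {i. odd i \<and> i < n \<and> i \<in> F \<and> i + 1 \<in> F}"
  let ?Q = "\<lambda>F. \<exists>i\<in>{1..n}. odd i \<and> i \<in> F \<and> (i < n \<longrightarrow> i + 1 \<notin> F)"
  have fin: "finite (?P G)" by simp
  have sub: "?P F \<subseteq> ?P G" using assms by blast
  show ?thesis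
  \<comment> \<open>With the same complete pairs, an unpaired odd index stays unpaired in
    \<open>G\<close>. A new complete pair adds 2, which outweighs the loss of the last
    summand.\<close>
  proof (cases "?P F = ?P G")
    case True
    have "?Q F \<longrightarrow> ?Q G" using assms True by blast
    then show ?thesis unfolding weight_def True by auto
  next
    case False
    then have "card (?P F) < card (?P G)" using sub fin by (meson psubsetI psubset_card_mono)
    then show ?thesis unfolding weight_def by (auto simp: of_bool_def)
  qed
qed

text \<open>The weight counts distinct elements of \<open>{1..n}\<close>: the complete pairs are
  disjoint, and an unpaired odd index lies in none of them.\<close>

lemma weight_le: "weight n F \<le> n"
proof -
  let ?P = "{i. odd i \<and> i < n \<and> i \<in> F \<and> i + 1 \<in> F}"
  let ?E = "?P \<union> Suc ` ?P"
  have card_E: "card ?E = 2 * card ?P"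
    by (subst card_Un_disjoint) (auto simp: card_image)
  have E: "?E \<subseteq> {1..n}" by (auto dest: odd_pos)
  show ?thesis
  proof (cases "odd (weight n F)")
    case False
    then have "weight n F = card ?E" unfolding odd_weight_iff card_E by (simp add: weight_def)
    then show ?thesis using card_mono[OF _ E] by simp
  next
    case True
    then obtain i where i: "i \<in> {1..n}" "odd i" "i \<in> F" "i < n \<longrightarrow> i + 1 \<notin> F"
      unfolding odd_weight_iff by blast
    then have "i \<notin> ?E" by auto
    moreover have "weight n F = Suc (card ?E)"
      using True unfolding odd_weight_iff card_E by (simp add: weight_def)
    ultimately have "weight n F = card (insert i ?E)" by simp
    then show ?thesis using card_mono[of "{1..n}" "insert i ?E"] E i by simp
  qed
qed

lemma (in acceptable_numbering) nested_ce_sets: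
  assumes S: "\<And>i. i \<in> {1..n} \<Longrightarrow> ce_set \<phi> (S i)"
  obtains T where "\<And>i. ce_set \<phi> (T i)" "\<And>i. T (i + 1) \<subseteq> T i" "D n T = D n S"
proof
  define I where "I e = {i \<in> {1..n}. e \<in> S i}" for e
  define T where "T j = {e. j \<le> weight n (I e)}" for j
  show "T (i + 1) \<subseteq> T i" for i by (auto simp: T_def)
  show "ce_set \<phi> (T j)" for j
  proof -
    \<comment> \<open>Monotonicity of \<open>weight\<close> makes the condition positive: it
      suffices to confirm membership for some \<open>F\<close> of sufficient weight, without knowing
      all of \<open>I e\<close>.\<close>
    have "e \<in> T j \<longleftrightarrow> (\<exists>F\<in>{F. F \<subseteq> {1..n} \<and> j \<le> weight n F}. \<forall>i\<in>F. e \<in> S i)" for e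
    proof
      assume "e \<in> T j"
      then show "\<exists>F\<in>{F. F \<subseteq> {1..n} \<and> j \<le> weight n F}. \<forall>i\<in>F. e \<in> S i"
        by (intro bexI[of _ "I e"]) (auto simp: T_def I_def)
    next
      assume "\<exists>F\<in>{F. F \<subseteq> {1..n} \<and> j \<le> weight n F}. \<forall>i\<in>F. e \<in> S i"
      then obtain F where F: "F \<subseteq> {1..n}" "j \<le> weight n F" "\<forall>i\<in>F. e \<in> S i" by blast
      then have "F \<subseteq> I e" by (auto simp: I_def)
      then show "e \<in> T j" using weight_mono[of F "I e" n] F(2) by (simp add: T_def)
    qed
    moreover have "semidecidable (\<lambda>e. \<exists>F\<in>{F. F \<subseteq> {1..n} \<and> j \<le> weight n F}. \<forall>i\<in>F. e \<in> S i)"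
    proof (intro semidecidable_ex_finite semidecidable_all_finite)
      show "finite {F. F \<subseteq> {1..n} \<and> j \<le> weight n F}"
        by (rule finite_subset[of _ "Pow {1..n}"]) auto
    qed (use S in \<open>auto simp: ce_set_iff_semidecidable intro: finite_subset\<close>)
    ultimately show ?thesis unfolding ce_set_iff_semidecidable by simp
  qed
  have "e \<in> D n T \<longleftrightarrow> e \<in> D n S" for e
  proof -
    have "e \<in> D n T \<longleftrightarrow> odd (weight n (I e))"
      by (rule D_downward_closed[OF weight_le]) (simp add: T_def)
    also have "\<dots> \<longleftrightarrow> e \<in> D n S"
      unfolding odd_weight_iff mem_D_iff by (auto simp: I_def)
    finally show ?thesis .
  qed
  then show "D n T = D n S" by blast
qed

lemma computable_sum:
  "finite I \<Longrightarrow> (\<And>i. i \<in> I \<Longrightarrow> computable (f i)) \<Longrightarrow> computable (\<lambda>x. \<Sum>i\<in>I. f i x)"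
  by (induction rule: finite_induct) (auto intro: computable_basic)

text \<open>Provides the phase counter of the construction: the number of sets seen to contain
  \<open>q\<close> before stage \<open>t\<close>. Searching all \<open>s < t\<close> makes it
  monotone.\<close>

lemma (in acceptable_numbering) enumeration_count:
  fixes n :: nat
  assumes "\<forall>i\<in>{1..n}. ce_set \<phi> (C i)"
  obtains cnt where "computable (\<lambda>z. cnt (pfst z) (psnd z))"
    "\<And>t t' q. t \<le> t' \<Longrightarrow> cnt t q \<le> cnt t' q"
    "\<And>q. \<exists>t0. \<forall>t\<ge>t0. cnt t q = card {i \<in> {1..n}. q \<in> C i}"
proof -
  have "\<forall>i\<in>{1..n}. \<exists>R. decidable (\<lambda>z. R (pfst z) (psnd z)) \<and> (\<forall>q. q \<in> C i \<longleftrightarrow> (\<exists>s. R s q))"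
    using assms unfolding ce_set_iff_semidecidable semidecidable_def by blast
  from bchoice[OF this] obtain R where
    R: "\<And>i. i \<in> {1..n} \<Longrightarrow> decidable (\<lambda>z. R i (pfst z) (psnd z))"
       "\<And>i q. i \<in> {1..n} \<Longrightarrow> q \<in> C i \<longleftrightarrow> (\<exists>s. R i s q)" by blast
  define cnt :: "nat \<Rightarrow> nat \<Rightarrow> nat" where "cnt t q = (\<Sum>i\<in>{1..n}. of_bool (\<exists>s<t. R i s q))" for t q
  show ?thesis
  proof
    have "computable (\<lambda>z. of_bool (\<exists>s<pfst z. R i s (psnd z)))" if "i \<in> {1..n}" for i
      unfolding decidable_def[symmetric]
      by (intro decidable_ex_less decidable_compose2[OF R(1)[OF that]] computable_basic)
    then show "computable (\<lambda>z. cnt (pfst z) (psnd z))"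
      unfolding cnt_def by (intro computable_sum) auto
    show "cnt t q \<le> cnt t' q" if "t \<le> t'" for t t' q
      unfolding cnt_def by (intro sum_mono) (use that in \<open>auto simp: of_bool_def intro: less_le_trans\<close>)
    show "\<exists>t0. \<forall>t\<ge>t0. cnt t q = card {i \<in> {1..n}. q \<in> C i}" for q
    proof -
      have "eventually (\<lambda>t. \<forall>i\<in>{1..n}. (\<exists>s<t. R i s q) \<longleftrightarrow> q \<in> C i) sequentially"
      proof (intro eventually_ball_finite ballI)
        fix i assume i: "i \<in> {1..n}"
        show "eventually (\<lambda>t. (\<exists>s<t. R i s q) \<longleftrightarrow> q \<in> C i) sequentially"
        proof (cases "q \<in> C i")
          case True
          then obtain s where "R i s q" using R(2)[OF i] by blast
          then show ?thesis using True
            by (intro eventually_mono[OF eventually_gt_at_top[of s]]) blast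
        qed (use R(2)[OF i] in auto)
      qed simp
      then obtain t0 where t0: "\<And>t i. t \<ge> t0 \<Longrightarrow> i \<in> {1..n} \<Longrightarrow> (\<exists>s<t. R i s q) \<longleftrightarrow> q \<in> C i"
        unfolding eventually_sequentially by blast
      have "cnt t q = card {i \<in> {1..n}. q \<in> C i}" if "t \<ge> t0" for t
      proof -
        have "cnt t q = (\<Sum>i\<in>{1..n}. of_bool (q \<in> C i))"
          unfolding cnt_def using t0[OF that] by (intro sum.cong) auto
        also have "\<dots> = card {i \<in> {1..n}. q \<in> C i}"
          by (simp add: of_bool_def sum.If_cases Int_def)
        finally show ?thesis .
      qed
      then show ?thesis by blast
    qed
  qed
qed

section \<open>From open sets indexed by complexity to Markov names\<close>

context effective_space
begin

lemma markov_name_exists: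
  assumes "x \<in> computable_points X B"
  shows "\<exists>e. markov_name \<phi> B e x"
proof -
  obtain p where "computable p" "type2_name B p x"
    using assms unfolding computable_points_def by blast
  then show ?thesis unfolding markov_name_def by (metis index_of_computable)
qed

lemma K_le_program_length: "markov_name \<phi> B e x \<Longrightarrow> K \<phi> B x \<le> program_length e"
  unfolding K_def by (rule Least_le) blast

text \<open>Supplies the bound \<open>N = 2 ^ Suc k\<close>: an index \<open>e\<close> of length
  \<open>l\<close> satisfies \<open>e + 1 < 2 ^ Suc l\<close>.\<close>

lemma short_markov_name:
  assumes "x \<in> computable_points_upto \<phi> X B k"
  obtains e where "markov_name \<phi> B e x" "e < 2 ^ Suc k"
proof -
  have x: "x \<in> computable_points X B" "K \<phi> B x \<le> k"
    using assms unfolding computable_points_upto_def by auto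
  have "\<exists>l e. markov_name \<phi> B e x \<and> program_length e = l" using markov_name_exists[OF x(1)] by blast
  from LeastI_ex[OF this] obtain e where e: "markov_name \<phi> B e x" "program_length e = K \<phi> B x"
    unfolding K_def by blast
  have "e + 1 < 2 * 2 ^ floor_log (e + 1)" by (rule floor_log_exp2_gt)
  also have "\<dots> \<le> 2 ^ Suc k" using e(2) x(2) by (simp add: program_length_def)
  finally show ?thesis using that e(1) by simp
qed

text \<open>Turns membership of \<open>x\<close> in an effective open set into a semidecidable
  property of the name \<open>e\<close>.\<close>

lemma markov_name_mem_iff:
  assumes "markov_name \<phi> B e x"
  shows "(\<exists>t v. \<phi> e t = Some v \<and> v \<in> I) \<longleftrightarrow> x \<in> (\<Union>i\<in>I. B i)"
proof -
  obtain p where p: "\<And>t. \<phi> e t = Some (p t)" "range p = {i. x \<in> B i}"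
    using assms unfolding markov_name_def type2_name_def by blast
  have "(\<exists>t v. \<phi> e t = Some v \<and> v \<in> I) \<longleftrightarrow> (\<exists>v\<in>range p. v \<in> I)" by (auto simp: p(1))
  then show ?thesis unfolding p(2) by blast
qed

text \<open>Replaces the logarithm by comparisons of powers, which are visibly decidable.\<close>

lemma program_length_eq_iff: "program_length e = l \<longleftrightarrow> 2 ^ l \<le> Suc e \<and> Suc e < 2 ^ Suc l"
  unfolding program_length_def using floor_log_eqI[of "Suc e" l] floor_log_exp2_le[of "Suc e"]
    floor_log_exp2_gt[of "Suc e"] by auto

lemma markov_n_ce_if_K_n_ce:
  assumes "K_n_ce \<phi> X B n A"
  shows "markov_n_ce \<phi> X B n A"
proof -
  obtain U where U: "\<forall>i\<in>{1..n}. uniformly_effective_open \<phi> B (U i)"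
    and A: "\<And>k. A \<inter> computable_points_upto \<phi> X B k =
             D n (\<lambda>i. U i k) \<inter> computable_points_upto \<phi> X B k"
    using assms unfolding K_n_ce_def by blast
  have "\<forall>i\<in>{1..n}. \<exists>h. computable h \<and> (\<forall>k. U i k = (\<Union>j\<in>W \<phi> (h k). B j))"
    using U unfolding uniformly_effective_open_def .
  from bchoice[OF this] obtain h where
    h: "\<And>i. i \<in> {1..n} \<Longrightarrow> computable (h i)"
       "\<And>i k. i \<in> {1..n} \<Longrightarrow> U i k = (\<Union>j\<in>W \<phi> (h i k). B j)" by blast
  define S where "S i = {e. \<exists>l t v. program_length e = l \<and> \<phi> e t = Some v \<and> v \<in> W \<phi> (h i l)}" for i
  have S: "ce_set \<phi> (S i)" if "i \<in> {1..n}" for i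
    unfolding ce_set_iff_semidecidable S_def mem_Collect_eq program_length_eq_iff
    by (intro semidecidable_ex semidecidable_conj semidecidable_enumeration semidecidable_W
      semidecidable_decidable[OF decidable_le] semidecidable_decidable[OF decidable_less]
      computable_power computable_basic computable_compose[OF h(1)[OF that]])
  \<comment> \<open>The sets \<open>U i k\<close> are not assumed to decrease in \<open>i\<close>,
    hence neither do the \<open>S i\<close>; nesting is restored here.\<close>
  obtain T where T: "\<And>i. ce_set \<phi> (T i)" "\<And>i. T (i + 1) \<subseteq> T i" "D n T = D n S"
    by (rule nested_ce_sets[of n S, OF S]) (assumption, rule that)
  have "x \<in> A \<longleftrightarrow> e \<in> D n T" if "x \<in> computable_points X B" and e: "markov_name \<phi> B e x" for x e
  proof -
    let ?l = "program_length e"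
    have "x \<in> computable_points_upto \<phi> X B ?l"
      using that K_le_program_length unfolding computable_points_upto_def by blast
    then have "x \<in> A \<longleftrightarrow> x \<in> D n (\<lambda>i. U i ?l)" using A[of ?l] by blast
    also have "\<dots> \<longleftrightarrow> e \<in> D n S"
    proof -
      have *: "x \<in> U i ?l \<longleftrightarrow> e \<in> S i" if "i \<in> {1..n}" for i
        unfolding h(2)[OF that] S_def using markov_name_mem_iff[OF e, of "W \<phi> (h i ?l)"] by auto
      show ?thesis
        unfolding mem_D_iff by (intro bex_cong refl conj_cong imp_cong) (use * in auto)
    qed
    finally show ?thesis unfolding T(3) .
  qed
  then show ?thesis unfolding markov_n_ce_def using T(1,2) by blast
qed

end

section \<open>From Markov names to effective open sets\<close>

text \<open>A tuple \<open>e\<^sub>0, \<dots>, e\<^sub>n < N\<close> is coded by the number with these base \<open>N\<close> digits, so that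
  quantification over tuples becomes a bounded number quantifier.\<close>

definition digit :: "nat \<Rightarrow> nat \<Rightarrow> nat \<Rightarrow> nat" where
  "digit N p i = p div N ^ i mod N"

text \<open>Lets a tuple be chosen in three steps: the earlier entries \<open>a\<close>, the entry
  \<open>e\<close>, and the later entries \<open>b\<close>.\<close>

lemma digit_eq: "a < N ^ i \<Longrightarrow> e < N \<Longrightarrow> digit N (a + N ^ i * (e + N * b)) i = e"
  unfolding digit_def by (simp add: div_mult_self2 div_less)

context effective_space
begin

text \<open>The set of points consistent with the first outputs of program \<open>q\<close>, up to some stage at
  which \<open>i\<close> of the sets have accepted \<open>q\<close>.\<close>

definition consistent_at :: "(nat \<Rightarrow> nat \<Rightarrow> nat) \<Rightarrow> nat \<Rightarrow> nat \<Rightarrow> 'a set" where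
  "consistent_at cnt i q =
     {x \<in> topspace X. \<exists>t. i \<le> cnt t q \<and> (\<forall>s<t. \<exists>v. \<phi> q s = Some v \<and> x \<in> B v)}"

text \<open>Rewrites the set in the shape of the closure lemmas: quantifiers become unions and
  bounded intersections, side conditions become all-or-nothing sets.\<close>

lemma consistent_at_eq:
  "consistent_at cnt i q = (\<Union>t. {x \<in> topspace X. i \<le> cnt t q} \<inter>
     (topspace X \<inter> (\<Inter>s<t. \<Union>v. {x \<in> topspace X. \<phi> q s = Some v} \<inter> B v)))"
  unfolding consistent_at_def by auto

lemma effective_family_consistent_at:
  assumes cnt: "computable (\<lambda>z. cnt (pfst z) (psnd z))" and "computable i" "computable q"
  shows "effective_family (\<lambda>k. consistent_at cnt (i k) (q k))"
  unfolding consistent_at_eq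
  by (intro effective_family_UN effective_family_Int effective_family_INT_less
    effective_family_semidecidable effective_family_basis semidecidable_decidable[OF decidable_le]
    semidecidable_enumeration computable_uncurry[OF cnt] computable_compose[OF assms(2)]
    computable_compose[OF assms(3)] computable_basic)

text \<open>The pairing makes \<open>pfst s\<close> take every value infinitely often, so that a program which
  switches to \<open>\<phi> e \<circ> pfst\<close> at an arbitrary stage still enumerates the full range of \<open>\<phi> e\<close>.\<close>

lemma consistent_at_step:
  assumes mono: "\<And>t t' q. t \<le> t' \<Longrightarrow> cnt t q \<le> cnt t' q"
    and lim: "\<forall>t\<ge>t0. cnt t q = m"
    and q: "\<And>s. cnt s q = i \<Longrightarrow> \<phi> q s = \<phi> e (pfst s)"
    and e: "markov_name \<phi> B e x"
    and x: "x \<in> consistent_at cnt i q" "x \<notin> consistent_at cnt (Suc i) q"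
  shows "markov_name \<phi> B q x" "m = i"
proof -
  obtain p where p: "\<And>s. \<phi> e s = Some (p s)" "range p = {i. x \<in> B i}"
    using e unfolding markov_name_def type2_name_def by blast
  obtain t where t: "x \<in> topspace X" "i \<le> cnt t q" "\<forall>s<t. \<exists>v. \<phi> q s = Some v \<and> x \<in> B v"
    using x(1) unfolding consistent_at_def by blast
  \<comment> \<open>Before stage \<open>t\<close> this is consistency; from \<open>t\<close> on the
    count is exactly \<open>i\<close>, and \<open>q\<close> copies the name
    \<open>e\<close>.\<close>
  have out: "\<exists>v. \<phi> q s = Some v \<and> x \<in> B v" if "cnt s q \<le> i" for s
  proof (cases "s < t")
    case False
    then have "cnt s q = i" using mono[of t s q] t(2) that by simp
    then show ?thesis using q[of s] p by auto
  qed (use t(3) in blast)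
  \<comment> \<open>At the first stage where the count exceeds \<open>i\<close>, all earlier outputs
    are still consistent with \<open>x\<close>, which puts \<open>x\<close> into the next
    set.\<close>
  have bound: "cnt s q \<le> i" for s
  proof (rule ccontr)
    assume "\<not> cnt s q \<le> i"
    then have "\<exists>s. Suc i \<le> cnt s q" using not_less_eq_eq by blast
    then obtain s where s: "Suc i \<le> cnt s q" "\<And>s'. s' < s \<Longrightarrow> \<not> Suc i \<le> cnt s' q"
      using exists_least_iff[of "\<lambda>s. Suc i \<le> cnt s q"] by blast
    have "\<forall>s'<s. \<exists>v. \<phi> q s' = Some v \<and> x \<in> B v"
      using out s(2) not_less_eq_eq by blast
    then have "x \<in> consistent_at cnt (Suc i) q"
      unfolding consistent_at_def using t(1) s(1) by blast
    then show False using x(2) by blast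
  qed
  have cnt_eq: "cnt s q = i" if "t \<le> s" for s
    using bound[of s] mono[OF that, of q] t(2) by simp
  show "m = i" using lim cnt_eq[of "max t t0"] by auto
  have "\<forall>s. \<exists>v. \<phi> q s = Some v \<and> x \<in> B v" using out bound by blast
  then obtain p' where p': "\<And>s. \<phi> q s = Some (p' s)" "\<And>s. x \<in> B (p' s)" by metis
  have "range p' = {i. x \<in> B i}"
  proof
    show "{i. x \<in> B i} \<subseteq> range p'"
    proof
      fix v assume "v \<in> {i. x \<in> B i}"
      then obtain a where a: "v = p a" using p(2) by blast
      \<comment> \<open>At stage \<open>pair a t\<close>, phase \<open>i\<close> has been reached
        and \<open>q\<close> outputs \<open>p a\<close>.\<close>
      have "t \<le> pair a t" unfolding pair_def by (rule le_prod_encode_2)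
      then have "\<phi> q (pair a t) = Some (p a)" using q[OF cnt_eq] p(1) by simp
      then have "p' (pair a t) = v" using p'(1)[of "pair a t"] a by simp
      then show "v \<in> range p'" by blast
    qed
  qed (use p'(2) in blast)
  then show "markov_name \<phi> B q x"
    unfolding markov_name_def type2_name_def using p'(1) by blast
qed

lemma K_n_ce_if_markov_n_ce:
  assumes "markov_n_ce \<phi> X B n A"
  shows "K_n_ce \<phi> X B n A"
proof -
  obtain C where C: "\<forall>i\<in>{1..n}. ce_set \<phi> (C i)" "\<forall>i\<in>{1..<n}. C (i + 1) \<subseteq> C i"
    and A: "\<And>x e. x \<in> computable_points X B \<Longrightarrow> markov_name \<phi> B e x \<Longrightarrow> x \<in> A \<longleftrightarrow> e \<in> D n C"
    using assms unfolding markov_n_ce_def by blast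
  define lim where "lim q = card {i \<in> {1..n}. q \<in> C i}" for q
  have lim_le: "lim q \<le> n" for q
    unfolding lim_def using card_mono[of "{1..n}" "{i \<in> {1..n}. q \<in> C i}"] by fastforce
  have D_C: "q \<in> D n C \<longleftrightarrow> odd (lim q)" for q
    by (rule D_downward_closed[OF lim_le]) (use card_nested[OF C(2)] in \<open>simp add: lim_def\<close>)
  obtain cnt where cnt: "computable (\<lambda>z. cnt (pfst z) (psnd z))"
    and mono: "\<And>t t' q. t \<le> t' \<Longrightarrow> cnt t q \<le> cnt t' q"
    and cnt_lim: "\<And>q. \<exists>t0. \<forall>t\<ge>t0. cnt t q = lim q"
    using C(1) unfolding lim_def by (rule enumeration_count) blast
  have cnt_le: "cnt t q \<le> n" for t q
  proof -
    obtain t0 where "\<forall>t\<ge>t0. cnt t q = lim q" using cnt_lim by blast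
    then have "cnt (max t t0) q = lim q" by simp
    then show ?thesis using mono[of t "max t t0" q] lim_le[of q] by simp
  qed
  have "semidecidable (\<lambda>z. \<phi> (digit (pfst (pfst (psnd z))) (psnd (pfst (psnd z)))
      (cnt (pfst (psnd (psnd z))) (pfst z))) (pfst (pfst (psnd (psnd z)))) = Some (psnd (psnd (psnd z))))"
    unfolding digit_def
    by (intro semidecidable_enumeration computable_mod computable_div computable_power computable_uncurry[OF cnt] computable_basic)
  \<comment> \<open>At stage \<open>s\<close>, the program \<open>r (pair N p)\<close> reads its own
    count and follows the entry of the tuple \<open>p\<close> at that position.\<close>
  then obtain r where r: "computable r"
    "\<And>w. \<phi> (r w) = (\<lambda>s. \<phi> (digit (pfst w) (psnd w) (cnt s (r w))) (pfst s))"
    by (rule recursion_theorem[where \<psi> = "\<lambda>q w s. \<phi> (digit (pfst w) (psnd w) (cnt s q)) (pfst s)"]) blast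
  define V where "V N i p = consistent_at cnt i (r (pair N p))" for N i p
  \<comment> \<open>Here \<open>a\<close> codes the entries with index below \<open>i\<close>, and
    \<open>b\<close> the remaining \<open>Suc n - i\<close> ones.\<close>
  define inU where "inU N i x \<longleftrightarrow> (\<exists>a<N ^ i. \<forall>b<N ^ (Suc n - i). x \<in> V N i (a + N ^ i * b))" for N i x
  \<comment> \<open>Collecting all phases from \<open>j\<close> on makes \<open>U j k\<close>
    decrease in \<open>j\<close>.\<close>
  define U where "U j k = {x \<in> topspace X. \<exists>i. j \<le> i \<and> i \<le> n \<and> inU (2 ^ Suc k) i x}" for j k
  have "uniformly_effective_open \<phi> B (U j)" for j
  proof -
    have "U j = (\<lambda>k. \<Union>i. \<Union>a. {x \<in> topspace X. j \<le> i \<and> i \<le> n \<and> a < (2 ^ Suc k) ^ i} \<inter>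
      (topspace X \<inter> (\<Inter>b<(2 ^ Suc k) ^ (Suc n - i).
        consistent_at cnt i (r (pair (2 ^ Suc k) (a + (2 ^ Suc k) ^ i * b))))))"
      unfolding U_def inU_def V_def by (rule ext) blast
    moreover have "effective_family \<dots>"
      by (intro effective_family_UN effective_family_Int effective_family_INT_less
        effective_family_semidecidable effective_family_consistent_at[OF cnt] semidecidable_decidable
        decidable_conj decidable_le decidable_less computable_compose[OF r(1)] computable_power computable_basic)
    ultimately show ?thesis by (simp only: effective_family_uniformly_effective_open)
  qed
  moreover have "x \<in> A \<longleftrightarrow> x \<in> D n (\<lambda>j. U j k)" if x: "x \<in> computable_points_upto \<phi> X B k" for x k
  proof -
    let ?N = "2 ^ Suc k :: nat"
    obtain e where e: "markov_name \<phi> B e x" "e < ?N" using x by (rule short_markov_name)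
    have xc: "x \<in> computable_points X B" and xX: "x \<in> topspace X"
      using x unfolding computable_points_upto_def computable_points_def by auto
    \<comment> \<open>No output is required at \<open>t = 0\<close>, so phase 0 is always available
      and the maximum \<open>M\<close> exists.\<close>
    have inU_0: "inU ?N 0 x"
      unfolding inU_def V_def consistent_at_def using xX by auto
    define M where "M = Max {i. i \<le> n \<and> inU ?N i x}"
    have M_mem: "M \<in> {i. i \<le> n \<and> inU ?N i x}"
      unfolding M_def by (rule Max_in) (use inU_0 in auto)
    have M_ge: "i \<le> M" if "i \<le> n" "inU ?N i x" for i
      unfolding M_def by (rule Max_ge) (use that in auto)
    have M: "M \<le> n" "inU ?N M x" using M_mem by auto
    then obtain a where a: "a < ?N ^ M" "\<And>b. b < ?N ^ (Suc n - M) \<Longrightarrow> x \<in> V ?N M (a + ?N ^ M * b)"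
      unfolding inU_def by blast
    have pos: "0 < ?N ^ l" for l by simp
    \<comment> \<open>By maximality of \<open>M\<close>, the prefix \<open>a\<close> extended by
      \<open>e\<close> is no witness for phase \<open>Suc M\<close>. If \<open>M = n\<close>, the
      count never reaches \<open>Suc M\<close> and any \<open>b\<close> will do.\<close>
    have "\<exists>b<?N ^ (n - M). x \<notin> V ?N (Suc M) (a + ?N ^ M * (e + ?N * b))"
    proof (cases "M = n")
      case True
      have "x \<notin> V ?N (Suc M) p" for p
        unfolding V_def consistent_at_def using cnt_le True by (auto simp: not_less_eq_eq)
      then show ?thesis using pos by blast
    next
      case False
      then have "\<not> inU ?N (Suc M) x" using M_ge[of "Suc M"] M(1) by auto
      moreover have "a + ?N ^ M * e < ?N ^ Suc M"
      proof -
        have "a + ?N ^ M * e < ?N ^ M * Suc e" using a(1) by simp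
        also have "\<dots> \<le> ?N ^ M * ?N" using e(2) by (intro mult_le_mono2) simp
        finally show ?thesis by (simp only: power_Suc mult.commute)
      qed
      ultimately obtain b where "b < ?N ^ (Suc n - Suc M)"
          "x \<notin> V ?N (Suc M) (a + ?N ^ M * e + ?N ^ Suc M * b)"
        unfolding inU_def by blast
      moreover have "a + ?N ^ M * e + ?N ^ Suc M * b = a + ?N ^ M * (e + ?N * b)"
        by (simp only: power_Suc algebra_simps)
      ultimately show ?thesis by (metis diff_Suc_Suc)
    qed
    then obtain b where b: "b < ?N ^ (n - M)" "x \<notin> V ?N (Suc M) (a + ?N ^ M * (e + ?N * b))" by blast
    define p where "p = a + ?N ^ M * (e + ?N * b)"
    define q where "q = r (pair ?N p)"
    \<comment> \<open>The entries from \<open>M\<close> on are within the range of the universal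
      quantifier of phase \<open>M\<close>, so \<open>x\<close> is also consistent with
      \<open>q\<close> at phase \<open>M\<close>.\<close>
    have "e + ?N * b < ?N ^ (Suc n - M)"
    proof -
      have "e + ?N * b < ?N * Suc b" using e(2) by simp
      also have "\<dots> \<le> ?N * ?N ^ (n - M)" using b(1) by (intro mult_le_mono2) simp
      finally show ?thesis using M(1) by (simp only: Suc_diff_le power_Suc)
    qed
    then have mem: "x \<in> consistent_at cnt M q" "x \<notin> consistent_at cnt (Suc M) q"
      using a(2) b(2) unfolding p_def[symmetric] q_def V_def by (auto simp: p_def)
    have "digit ?N p M = e" unfolding p_def using a(1) e(2) by (rule digit_eq)
    then have step: "\<phi> q s = \<phi> e (pfst s)" if "cnt s q = M" for s
      using fun_cong[OF r(2)[of "pair ?N p"], of s] that unfolding q_def by simp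
    obtain t0 where t0: "\<forall>t\<ge>t0. cnt t q = lim q" using cnt_lim by blast
    have "markov_name \<phi> B q x" "lim q = M"
      using consistent_at_step[OF mono t0 step e(1) mem] by auto
    then have "x \<in> A \<longleftrightarrow> odd M" using A[OF xc] D_C by auto
    also have "\<dots> \<longleftrightarrow> x \<in> D n (\<lambda>j. U j k)"
      by (rule D_downward_closed[symmetric, OF M(1)])
         (use M M_ge xX in \<open>auto simp: U_def simp del: power_Suc intro: le_trans\<close>)
    finally show ?thesis .
  qed
  ultimately show ?thesis unfolding K_n_ce_def by blast
qed

end

theorem mainTheorem6:
  fixes \<phi> :: "nat \<Rightarrow> nat \<rightharpoonup> nat"
    and X :: "'a topology"
    and B :: "nat \<Rightarrow> 'a set"
    and n :: nat
    and A :: "'a set"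
  assumes "standard_enumeration \<phi>"
    and "effective_topological_space \<phi> X B"
    and "n \<ge> 1"
    and "A \<subseteq> computable_points X B"
  shows "markov_n_ce \<phi> X B n A \<longleftrightarrow> K_n_ce \<phi> X B n A"
proof -
  interpret effective_space \<phi> X B
    by unfold_locales (rule assms)+
  show ?thesis
    using K_n_ce_if_markov_n_ce markov_n_ce_if_K_n_ce by blast
qed

end
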